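(* Let $r\ge 1$ and let $\mu_1,\ldots,\mu_r$ be measures that are absolutely continuous with weights $w_1,\ldots,w_r$, i.e. $d\mu_k(t)=w_k(t)\,dt$, such that each $w_k$ vanishes at the endpoints of the support of $\mu_k$. Suppose that all multi-indices $\vec n=(n_1,\ldots,n_r)\in\mathbb N^r$ are normal and that for every $\vec n$ the functions $$\{w_1,xw_1,\ldots,x^{n_1-1}w_1,\;w_2,xw_2,\ldots,x^{n_2-1}w_2,\;\ldots,\;w_r,xw_r,\ldots,x^{n_r-1}w_r\}$$ are linearly independent. Put $v_k(x):=-\ln w_k(x)$. Then, for every multi-index $\vec n$ with $n_j\ge 1$ for all $j$, the type II multiple orthogonal polynomials satisfy the lowering equation $$P_{\vec n}'(x)=P_{\vec n}(x)\int P_{\vec n}(t)\sum_{k=1}^r A_{\vec n,k}(t)\frac{v_k'(t)-v_k'(x)}{x-t}w_k(t)\,dt-\sum_{j=1}^r a_{\vec n,j}P_{\vec n-\vec e_j}(x)\int P_{\vec n}(t)\sum_{k=1}^r A_{\vec n+\vec e_j,k}(t)\frac{v_k'(t)-v_k'(x)}{x-t}w_k(t)\,dt,$$ and, for $i=1,\ldots,r$, the raising equations $$P_{\vec n-\vec e_i}'(x)=P_{\vec n}(x)\int P_{\vec n-\vec e_i}(t)\sum_{k=1}^r A_{\vec n,k}(t)\frac{v_k'(t)-v_k'(x)}{x-t}w_k(t)\,dt-\sum_{j=1}^r\left(a_{\vec n,j}\int P_{\vec n-\vec e_i}(t)\sum_{k=1}^r A_{\vec n+\vec e_j,k}(t)\frac{v_k'(t)-v_k'(x)}{x-t}w_k(t)\,dt-v_i'(x)\delta_{i,j}\right)P_{\vec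 n-\vec e_j}(x),$$ where $\delta_{i,j}$ is the Kronecker delta.
   Context: The measures are supported on an oriented simple curve $\Gamma$ in the complex plane (for example an interval or the whole real line); all integrals are over $\Gamma$, with $w_k$ taken to be $0$ on $\Gamma$ off the support of $\mu_k$. The weights are assumed regular enough (differentiable, Hölder continuous, with all moments of $w_k$ and of $w_k'$ finite) for all integrals below and in the claim to exist; "vanishes at the endpoints" includes, for an infinite endpoint, that $x^m w_k(x)\to 0$ for every $m\geq 0$. Here $v_k'=-w_k'/w_k$, and the identities are understood at points $x$ at which $v_1',\ldots,v_r'$ are all defined (possibly by continuation off the support) and the integrals converge. Notation: $|\vec n|=n_1+\cdots+n_r$, and $\vec e_j$ is the $j$-th standard unit vector of $\mathbb N^r$. Type I multiple orthogonal polynomials: the vector $(A_{\vec n,1},\ldots,A_{\vec n,r})$ with $A_{\vec n,j}$ a polynomial of degree $\le n_j-1$ (zero if $n_j=0$) such that $\sum_{j=1}^r\int x^kA_{\vec n,j}(x)\,d\mu_j(x)=0$ for $k=0,1,\ldots,|\vec n|-2$ and $\sum_{j=1}^r\int x^{|\vec n|-1}A_{\vec n,j}(x)\,d\mu_j(x)=1$. Type II multiple orthogonal polynomial: the monic polynomial $P_{\vec n}$ of degree $|\vec n|$ such that $\int P_{\vec n}(x)x^k\,d\mu_j(x)=0$ for $k=0,\ldots,n_j-1$ and $j=1,\ldots,r$. Normal index: $\vec n$ is normal if the $|\vec n|\times|\vec n|$ matrix of mixed moments of the linear system defining the type I polynomials is nonsingular; its columns are $\left(\nu^{(j)}_{s},\nu^{(j)}_{s+1},\ldots,\nu^{(j)}_{s+|\vec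 n|-1}\right)^T$ for $s=0,\ldots,n_j-1$, $j=1,\ldots,r$, where $\nu^{(j)}_m=\int x^m\,d\mu_j(x)$. For a normal index both the type I vector and $P_{\vec n}$ exist and are unique. Recurrence coefficients: for $n_j\ge1$, $$a_{\vec n,j}=\frac{\int x^{n_j}P_{\vec n}(x)\,d\mu_j(x)}{\int x^{n_j-1}P_{\vec n-\vec e_j}(x)\,d\mu_j(x)},\qquad j=1,\ldots,r.$$ *)

theory Defs
  imports "HOL-Analysis.Analysis" "Jordan_Normal_Form.Determinant"
begin

text \<open>
  The curve \<open>\<Gamma>\<close> is the image of the open parameter interval \<open>einterval a b\<close> (with \<open>a\<close>, \<open>b\<close>
  extended reals) under \<open>\<gamma>\<close>, oriented by increasing parameter. The real line, for instance, is
  \<open>a = -\<infinity>\<close>, \<open>b = \<infinity>\<close>, \<open>\<gamma> = of_real\<close>. The end points are not part of \<open>\<Gamma>\<close>; they are described by the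
  limits of \<open>\<gamma>\<close> along the two filters below, and each of them is a finite point or \<open>\<infinity>\<close>.
\<close>

definition lower_end :: "ereal \<Rightarrow> real filter" where
  "lower_end a = filtermap real_of_ereal (at_right a)"

definition upper_end :: "ereal \<Rightarrow> real filter" where
  "upper_end b = filtermap real_of_ereal (at_left b)"

definition curve_set :: "ereal \<Rightarrow> ereal \<Rightarrow> (real \<Rightarrow> complex) \<Rightarrow> complex set" where
  "curve_set a b \<gamma> = \<gamma> ` einterval a b"

definition simple_curve :: "ereal \<Rightarrow> ereal \<Rightarrow> (real \<Rightarrow> complex) \<Rightarrow> bool" where
  "simple_curve a b \<gamma> \<longleftrightarrow>
     a < b \<and> inj_on \<gamma> (einterval a b) \<and>
     (\<forall>c d. a < ereal c \<and> c < d \<and> ereal d < b \<longrightarrow> \<gamma> piecewise_C1_differentiable_on {c..d}) \<and>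
     (\<forall>F \<in> {lower_end a, upper_end b}.
        filterlim \<gamma> at_infinity F \<or> (\<exists>p. p \<notin> curve_set a b \<gamma> \<and> (\<gamma> \<longlongrightarrow> p) F))"

text \<open>
  Both ends of \<open>\<gamma>\<close> run into the same finite point \<open>p\<close>: \<open>\<Gamma> \<union> {p}\<close> is then a closed simple curve,
  and \<open>p\<close> is not an end point of it.
\<close>
definition closes_up :: "ereal \<Rightarrow> ereal \<Rightarrow> (real \<Rightarrow> complex) \<Rightarrow> bool" where
  "closes_up a b \<gamma> \<longleftrightarrow> (\<exists>p. (\<gamma> \<longlongrightarrow> p) (lower_end a) \<and> (\<gamma> \<longlongrightarrow> p) (upper_end b))"

definition curve_integrable :: "ereal \<Rightarrow> ereal \<Rightarrow> (real \<Rightarrow> complex) \<Rightarrow> (complex \<Rightarrow> complex) \<Rightarrow> bool" where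
  "curve_integrable a b \<gamma> f \<longleftrightarrow>
     interval_lebesgue_integrable lborel a b (\<lambda>s. f (\<gamma> s) * vector_derivative \<gamma> (at s))"

definition curve_integral :: "ereal \<Rightarrow> ereal \<Rightarrow> (real \<Rightarrow> complex) \<Rightarrow> (complex \<Rightarrow> complex) \<Rightarrow> complex" where
  "curve_integral a b \<gamma> f = (LBINT s=a..b. f (\<gamma> s) * vector_derivative \<gamma> (at s))"

text \<open>Derivative along \<open>\<Gamma>\<close> (unique when it exists, since \<open>\<Gamma>\<close> has no isolated points); the value
  is \<open>0\<close> where there is no derivative.\<close>
definition curve_deriv :: "complex set \<Rightarrow> (complex \<Rightarrow> complex) \<Rightarrow> complex \<Rightarrow> complex" where
  "curve_deriv \<Gamma> f z =
     (if \<exists>d. (f has_field_derivative d) (at z within \<Gamma>)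
      then THE d. (f has_field_derivative d) (at z within \<Gamma>) else 0)"

text \<open>The support in \<open>\<Gamma>\<close> of the measure \<open>w(t) dt\<close>; \<open>w\<close> is automatically \<open>0\<close> on \<open>\<Gamma>\<close> off this set.\<close>
definition weight_support :: "complex set \<Rightarrow> (complex \<Rightarrow> complex) \<Rightarrow> complex set" where
  "weight_support \<Gamma> w = \<Gamma> \<inter> closure {z \<in> \<Gamma>. w z \<noteq> 0}"

definition locally_holder_on :: "complex set \<Rightarrow> (complex \<Rightarrow> complex) \<Rightarrow> bool" where
  "locally_holder_on S f \<longleftrightarrow>
     (\<forall>K. compact K \<and> K \<subseteq> S \<longrightarrow>
        (\<exists>\<alpha> C. 0 < \<alpha> \<and> \<alpha> \<le> 1 \<and> (\<forall>x\<in>K. \<forall>y\<in>K. norm (f x - f y) \<le> C * dist x y powr \<alpha>)))"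

definition regular_weight :: "ereal \<Rightarrow> ereal \<Rightarrow> (real \<Rightarrow> complex) \<Rightarrow> (complex \<Rightarrow> complex) \<Rightarrow> bool" where
  "regular_weight a b \<gamma> w \<longleftrightarrow>
     (let \<Gamma> = curve_set a b \<gamma>; S = weight_support \<Gamma> w in
       (\<forall>z \<in> (top_of_set \<Gamma>) interior_of S. \<exists>d. (w has_field_derivative d) (at z within \<Gamma>)) \<and>
       locally_holder_on S w \<and>
       (\<forall>m::nat. curve_integrable a b \<gamma> (\<lambda>t. t ^ m * w t)) \<and>
       (\<forall>m::nat. curve_integrable a b \<gamma> (\<lambda>t. t ^ m * curve_deriv \<Gamma> w t)))"

text \<open>
  The end points of the support are its boundary points relative to \<open>\<Gamma>\<close> and those ends of \<open>\<Gamma>\<close> that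
  it reaches (at the other ends the limits below are trivial). At a finite end the condition for
  all \<open>m\<close> amounts to \<open>w \<longlongrightarrow> 0\<close>. If \<open>\<Gamma>\<close> closes up, the closing point need not be an end point of the
  support, and one only has continuity of \<open>w\<close> there.
\<close>
definition vanishes_at_endpoints :: "ereal \<Rightarrow> ereal \<Rightarrow> (real \<Rightarrow> complex) \<Rightarrow> (complex \<Rightarrow> complex) \<Rightarrow> bool" where
  "vanishes_at_endpoints a b \<gamma> w \<longleftrightarrow>
     (let \<Gamma> = curve_set a b \<gamma> in
       (\<forall>z \<in> (top_of_set \<Gamma>) frontier_of (weight_support \<Gamma> w). w z = 0) \<and>
       ((\<forall>F \<in> {lower_end a, upper_end b}. \<forall>m::nat. ((\<lambda>s. \<gamma> s ^ m * w (\<gamma> s)) \<longlongrightarrow> 0) F) \<or>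
        (closes_up a b \<gamma> \<and> (\<exists>l. \<forall>F \<in> {lower_end a, upper_end b}. ((\<lambda>s. w (\<gamma> s)) \<longlongrightarrow> l) F))))"

definition weight_integral ::
    "ereal \<Rightarrow> ereal \<Rightarrow> (real \<Rightarrow> complex) \<Rightarrow> (nat \<Rightarrow> complex \<Rightarrow> complex) \<Rightarrow> nat \<Rightarrow> (complex \<Rightarrow> complex) \<Rightarrow> complex" where
  "weight_integral a b \<gamma> w j f = curve_integral a b \<gamma> (\<lambda>t. f t * w j t)"

text \<open>
  Multiple orthogonality with respect to \<open>\<mu>\<^sub>1, \<dots>, \<mu>\<^sub>r\<close>; below, \<open>L j f\<close> stands for the integral of \<open>f\<close>
  with respect to \<open>\<mu>\<^sub>j\<close>. A multi-index is a function \<open>n\<close> of which only the values \<open>n j\<close> for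
  \<open>j \<in> {1..r}\<close> matter.
\<close>

definition msize :: "nat \<Rightarrow> (nat \<Rightarrow> nat) \<Rightarrow> nat" where
  "msize r n = (\<Sum>j=1..r. n j)"

definition add_unit :: "(nat \<Rightarrow> nat) \<Rightarrow> nat \<Rightarrow> nat \<Rightarrow> nat" where
  "add_unit n j = n(j := n j + 1)"

definition sub_unit :: "(nat \<Rightarrow> nat) \<Rightarrow> nat \<Rightarrow> nat \<Rightarrow> nat" where
  "sub_unit n j = n(j := n j - 1)"

definition moment_matrix :: "nat \<Rightarrow> (nat \<Rightarrow> (complex \<Rightarrow> complex) \<Rightarrow> complex) \<Rightarrow> (nat \<Rightarrow> nat) \<Rightarrow> complex mat" where
  "moment_matrix r L n = mat_of_cols_list (msize r n)
     (concat (map (\<lambda>j. map (\<lambda>s. map (\<lambda>i. L j (\<lambda>x. x ^ (s + i))) [0..<msize r n]) [0..<n j]) [1..<r + 1]))"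

definition normal_index :: "nat \<Rightarrow> (nat \<Rightarrow> (complex \<Rightarrow> complex) \<Rightarrow> complex) \<Rightarrow> (nat \<Rightarrow> nat) \<Rightarrow> bool" where
  "normal_index r L n \<longleftrightarrow> Determinant.det (moment_matrix r L n) \<noteq> 0"

text \<open>For \<open>|n| = 0\<close> there is no normalization, and the type I vector is zero.\<close>
definition is_type_I ::
    "nat \<Rightarrow> (nat \<Rightarrow> (complex \<Rightarrow> complex) \<Rightarrow> complex) \<Rightarrow> (nat \<Rightarrow> nat) \<Rightarrow> (nat \<Rightarrow> complex poly) \<Rightarrow> bool" where
  "is_type_I r L n A \<longleftrightarrow>
     (\<forall>j\<in>{1..r}. if n j = 0 then A j = 0 else degree (A j) \<le> n j - 1) \<and>
     (\<forall>j. j \<notin> {1..r} \<longrightarrow> A j = 0) \<and>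
     (\<forall>k. k + 2 \<le> msize r n \<longrightarrow> (\<Sum>j=1..r. L j (\<lambda>x. x ^ k * poly (A j) x)) = 0) \<and>
     (1 \<le> msize r n \<longrightarrow> (\<Sum>j=1..r. L j (\<lambda>x. x ^ (msize r n - 1) * poly (A j) x)) = 1)"

definition is_type_II ::
    "nat \<Rightarrow> (nat \<Rightarrow> (complex \<Rightarrow> complex) \<Rightarrow> complex) \<Rightarrow> (nat \<Rightarrow> nat) \<Rightarrow> complex poly \<Rightarrow> bool" where
  "is_type_II r L n p \<longleftrightarrow>
     lead_coeff p = 1 \<and> degree p = msize r n \<and>
     (\<forall>j\<in>{1..r}. \<forall>k<n j. L j (\<lambda>x. poly p x * x ^ k) = 0)"

text \<open>Both polynomials exist and are unique if \<open>n\<close> is a normal index.\<close>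
definition type_I :: "nat \<Rightarrow> (nat \<Rightarrow> (complex \<Rightarrow> complex) \<Rightarrow> complex) \<Rightarrow> (nat \<Rightarrow> nat) \<Rightarrow> nat \<Rightarrow> complex poly" where
  "type_I r L n = (THE A. is_type_I r L n A)"

definition type_II :: "nat \<Rightarrow> (nat \<Rightarrow> (complex \<Rightarrow> complex) \<Rightarrow> complex) \<Rightarrow> (nat \<Rightarrow> nat) \<Rightarrow> complex poly" where
  "type_II r L n = (THE p. is_type_II r L n p)"

definition rec_coeff :: "nat \<Rightarrow> (nat \<Rightarrow> (complex \<Rightarrow> complex) \<Rightarrow> complex) \<Rightarrow> (nat \<Rightarrow> nat) \<Rightarrow> nat \<Rightarrow> complex" where
  "rec_coeff r L n j =
     L j (\<lambda>x. x ^ n j * poly (type_II r L n) x) /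
     L j (\<lambda>x. x ^ (n j - 1) * poly (type_II r L (sub_unit n j)) x)"

text \<open>Independence over \<open>\<complex>\<close>, as functions on \<open>\<Gamma>\<close>, of the family (not just the set) of all
  \<open>x\<^sup>s w\<^sub>k\<close> with \<open>s < n k\<close>.\<close>
definition weights_independent :: "complex set \<Rightarrow> nat \<Rightarrow> (nat \<Rightarrow> complex \<Rightarrow> complex) \<Rightarrow> (nat \<Rightarrow> nat) \<Rightarrow> bool" where
  "weights_independent \<Gamma> r w n \<longleftrightarrow>
     (\<forall>c :: nat \<Rightarrow> nat \<Rightarrow> complex.
        (\<forall>x\<in>\<Gamma>. (\<Sum>k=1..r. \<Sum>s<n k. c k s * (x ^ s * w k x)) = 0) \<longrightarrow>
        (\<forall>k\<in>{1..r}. \<forall>s<n k. c k s = 0))"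

text \<open>
  \<open>v' k\<close> is the derivative of \<open>- ln (w k)\<close>, that is \<open>- w' / w\<close>, where \<open>w k\<close> does not vanish on \<open>\<Gamma>\<close>.
  Elsewhere it may be continued in any way: at points \<open>t\<close> of integration these values are multiplied
  by \<open>w k t = 0\<close>, so only the continued value at the evaluation point \<open>x\<close> enters.
\<close>
definition neg_log_deriv ::
    "complex set \<Rightarrow> nat \<Rightarrow> (nat \<Rightarrow> complex \<Rightarrow> complex) \<Rightarrow> (nat \<Rightarrow> complex \<Rightarrow> complex) \<Rightarrow> bool" where
  "neg_log_deriv \<Gamma> r w v' \<longleftrightarrow>
     (\<forall>k\<in>{1..r}. \<forall>t\<in>\<Gamma>. w k t \<noteq> 0 \<longrightarrow> v' k t = - curve_deriv \<Gamma> (w k) t / w k t)"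

definition ladder_integrand ::
    "nat \<Rightarrow> (nat \<Rightarrow> complex \<Rightarrow> complex) \<Rightarrow> (nat \<Rightarrow> complex \<Rightarrow> complex) \<Rightarrow>
     complex poly \<Rightarrow> (nat \<Rightarrow> complex poly) \<Rightarrow> complex \<Rightarrow> complex \<Rightarrow> complex" where
  "ladder_integrand r w v' p A x t =
     poly p t * (\<Sum>k=1..r. poly (A k) t * ((v' k t - v' k x) / (x - t)) * w k t)"

end

theory Submission
  imports Defs
begin

text \<open>
  Normality of \<open>n\<close> yields polynomials \<open>K\<^sub>k\<close> of degree less than \<open>n\<^sub>k\<close>, depending on \<open>x\<close>, with
  \<open>\<Sum>\<^sub>k \<integral> p K\<^sub>k d\<mu>\<^sub>k = p(x)\<close> for all polynomials \<open>p\<close> of degree less than \<open>|n|\<close>. By a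
  Christoffel-Darboux formula, \<open>(x - t) K\<^sub>k(t)\<close> is the combination of \<open>A\<^sub>n\<^sub>,\<^sub>k\<close> and the
  \<open>A\<^sub>n\<^sub>+\<^sub>e\<^sub>j\<^sub>,\<^sub>k\<close> that occurs in the ladder equations, so that the factor \<open>1 / (x - t)\<close> cancels
  and their right-hand sides become \<open>\<Sum>\<^sub>k \<integral> p K\<^sub>k (v\<^sub>k' - v\<^sub>k'(x)) w\<^sub>k dt\<close>. As \<open>v\<^sub>k' w\<^sub>k = - w\<^sub>k'\<close>
  and \<open>w\<^sub>k\<close> vanishes at the end points, integration by parts gives
  \<open>\<Sum>\<^sub>k \<integral> (p' K\<^sub>k + p K\<^sub>k' - v\<^sub>k'(x) p K\<^sub>k) d\<mu>\<^sub>k\<close>. Here the first term is \<open>p'(x)\<close>, and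
  orthogonality removes the others, except for \<open>v\<^sub>i'(x) p(x)\<close> if \<open>p = P\<^sub>n\<^sub>-\<^sub>e\<^sub>i\<close>.

  The support of a weight may have infinitely many end points in \<open>\<Gamma>\<close>, at which the weight is merely
  continuous. Integration by parts therefore rests on a fundamental theorem of calculus for
  continuous functions whose derivative exists, up to finitely many exceptions, off their zeros.
\<close>

hide_const (open) Module.smult

section \<open>Type I and type II polynomials\<close>

text \<open>\<open>B\<close> is the inverse of the moment matrix, whose columns are indexed by the pairs \<open>(j, s)\<close>.\<close>
lemma normal_index_inverse:
  assumes "normal_index r L n"
  obtains B :: "nat \<Rightarrow> nat \<Rightarrow> nat \<Rightarrow> complex" where
    "\<And>i i'. i < msize r n \<Longrightarrow> i' < msize r n \<Longrightarrow>
       (\<Sum>j=1..r. \<Sum>s<n j. L j (\<lambda>x. x ^ (s + i)) * B j s i') = (if i = i' then 1 else 0)"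
    "\<And>j s j' s'. j \<in> {1..r} \<Longrightarrow> s < n j \<Longrightarrow> j' \<in> {1..r} \<Longrightarrow> s' < n j' \<Longrightarrow>
       (\<Sum>i<msize r n. B j s i * L j' (\<lambda>x. x ^ (s' + i))) = (if j = j' \<and> s = s' then 1 else 0)"
proof -
  define N where "N = msize r n"
  define ps where "ps = concat (map (\<lambda>j. map (\<lambda>s. (j, s)) [0..<n j]) [1..<r + 1])"
  define I where "I = (SIGMA j:{1..r}. {..<n j})"
  define M where "M = moment_matrix r L n"
  have set_ps: "set ps = I"
    by (auto simp: ps_def I_def)
  have len_ps: "length ps = N"
    by (simp add: ps_def N_def msize_def length_concat o_def sum_list_distinct_conv_sum_set
        atLeastLessThanSuc_atLeastAtMost del: upt_Suc)
  \<comment> \<open>A list as long as the set of its entries has no repetitions, so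
    \<open>ps\<close> numbers the columns bijectively by the pairs in \<open>I\<close>.\<close>
  have "card (set ps) = length ps"
    unfolding set_ps len_ps by (simp add: I_def N_def msize_def)
  then have dist_ps: "distinct ps"
    by (rule card_distinct)
  have M_eq: "M = mat N N (\<lambda>(i, c). L (fst (ps ! c)) (\<lambda>x. x ^ (snd (ps ! c) + i)))"
  proof -
    have *: "concat (map (\<lambda>j. map (\<lambda>s. map (\<lambda>i. L j (\<lambda>x. x ^ (s + i))) [0..<N]) [0..<n j]) [1..<r + 1])
        = map (\<lambda>p. map (\<lambda>i. L (fst p) (\<lambda>x. x ^ (snd p + i))) [0..<N]) ps"
      by (simp add: ps_def map_concat o_def del: upt_Suc)
    show ?thesis
      unfolding M_def moment_matrix_def mat_of_cols_list_def N_def[symmetric] *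
      by (rule eq_matI) (auto simp: len_ps)
  qed
  have M: "M \<in> carrier_mat N N"
    by (simp add: M_eq)
  have "Determinant.det M \<noteq> 0"
    using assms by (simp add: normal_index_def M_def)
  \<comment> \<open>The inverse is two-sided: \<open>MC\<close> yields the first family of
    relations, \<open>CM\<close> the second.\<close>
  from det_non_zero_imp_unit[OF M this, of "()"]
  obtain C where C: "C \<in> carrier_mat N N" and CM: "C * M = 1\<^sub>m N" and MC: "M * C = 1\<^sub>m N"
    by (auto simp: Units_def ring_mat_def)
  have bij: "bij_betw (\<lambda>c. ps ! c) {..<N} I"
    using bij_betw_nth[OF dist_ps, of "{..<N}" I] by (simp add: set_ps len_ps)
  define pos where "pos = the_inv_into {..<N} (\<lambda>c. ps ! c)"
  have pos: "pos p < N" "ps ! pos p = p" if "p \<in> I" for p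
    using bij that f_the_inv_into_f_bij_betw[OF bij] the_inv_into_into[of "\<lambda>c. ps ! c" "{..<N}" p "{..<N}"]
    by (auto simp: pos_def bij_betw_def)
  have pos_nth: "pos (ps ! c) = c" if "c < N" for c
    using bij that by (auto simp: pos_def bij_betw_def the_inv_into_f_f)
  define B where "B = (\<lambda>j s i. C $$ (pos (j, s), i))"
  show thesis
  proof (rule that[of B])
    fix i i' assume i: "i < msize r n" "i' < msize r n"
    have "(\<Sum>j=1..r. \<Sum>s<n j. L j (\<lambda>x. x ^ (s + i)) * B j s i')
        = (\<Sum>p\<in>I. L (fst p) (\<lambda>x. x ^ (snd p + i)) * C $$ (pos p, i'))"
      by (simp add: I_def sum.Sigma B_def case_prod_unfold)
    also have "\<dots> = (\<Sum>c<N. L (fst (ps ! c)) (\<lambda>x. x ^ (snd (ps ! c) + i)) * C $$ (pos (ps ! c), i'))"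
      by (rule sum.reindex_bij_betw[OF bij, symmetric])
    also have "\<dots> = (\<Sum>c<N. M $$ (i, c) * C $$ (c, i'))"
      using i by (intro sum.cong) (auto simp: M_eq N_def[symmetric] pos_nth)
    also have "\<dots> = (M * C) $$ (i, i')"
      using M C i by (simp add: N_def[symmetric] scalar_prod_def lessThan_atLeast0)
    finally show "(\<Sum>j=1..r. \<Sum>s<n j. L j (\<lambda>x. x ^ (s + i)) * B j s i') = (if i = i' then 1 else 0)"
      using i by (simp add: MC N_def)
  next
    fix j s j' s' assume j: "j \<in> {1..r}" "s < n j" "j' \<in> {1..r}" "s' < n j'"
    then have I: "(j, s) \<in> I" "(j', s') \<in> I" by (auto simp: I_def)
    have "(\<Sum>i<msize r n. B j s i * L j' (\<lambda>x. x ^ (s' + i)))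
        = (\<Sum>i<N. C $$ (pos (j, s), i) * M $$ (i, pos (j', s')))"
      using pos[OF I(2)] by (intro sum.cong) (auto simp: M_eq N_def[symmetric] B_def)
    also have "\<dots> = (C * M) $$ (pos (j, s), pos (j', s'))"
      using M C pos(1)[OF I(1)] pos(1)[OF I(2)] by (simp add: scalar_prod_def lessThan_atLeast0)
    also have "\<dots> = (if pos (j, s) = pos (j', s') then 1 else 0)"
      using pos(1)[OF I(1)] pos(1)[OF I(2)] by (simp add: CM)
    also have "pos (j, s) = pos (j', s') \<longleftrightarrow> (j, s) = (j', s')"
      using pos(2)[OF I(1)] pos(2)[OF I(2)] by metis
    finally show "(\<Sum>i<msize r n. B j s i * L j' (\<lambda>x. x ^ (s' + i))) = (if j = j' \<and> s = s' then 1 else 0)"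
      by simp
  qed
qed

text \<open>Unlike \<open>degree p < N\<close>, this makes sense for \<open>N = 0\<close>: it then says \<open>p = 0\<close>.\<close>
definition deg_lt :: "'a::comm_ring_1 poly \<Rightarrow> nat \<Rightarrow> bool" where
  "deg_lt p N \<longleftrightarrow> (\<forall>i\<ge>N. coeff p i = 0)"

lemma deg_lt_0 [simp]: "deg_lt 0 N"
  and deg_lt_add: "deg_lt p N \<Longrightarrow> deg_lt q N \<Longrightarrow> deg_lt (p + q) N"
  and deg_lt_diff: "deg_lt p N \<Longrightarrow> deg_lt q N \<Longrightarrow> deg_lt (p - q) N"
  and deg_lt_smult: "deg_lt p N \<Longrightarrow> deg_lt (smult c p) N"
  and deg_lt_mono: "deg_lt p N \<Longrightarrow> N \<le> N' \<Longrightarrow> deg_lt p N'"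
  and deg_lt_monom: "i < N \<Longrightarrow> deg_lt (monom c i) N"
  and deg_lt_iff: "deg_lt p N \<longleftrightarrow> p = 0 \<or> degree p < N"
  by (auto simp: deg_lt_def coeff_eq_0) (meson leading_coeff_0_iff not_le)

lemma deg_lt_sum: "(\<And>i. i \<in> I \<Longrightarrow> deg_lt (f i) N) \<Longrightarrow> deg_lt (\<Sum>i\<in>I. f i) N"
  by (induction I rule: infinite_finite_induct) (auto intro: deg_lt_add)

lemma deg_lt_pderiv:
  fixes p :: "'a::idom poly"
  shows "deg_lt p N \<Longrightarrow> deg_lt (pderiv p) (N - 1)"
  by (auto simp: deg_lt_def coeff_pderiv)

lemma deg_lt_sum_monom:
  assumes "deg_lt p N"
  shows "p = (\<Sum>i<N. smult (coeff p i) (monom 1 i))"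
proof (rule poly_eqI)
  fix k
  have "coeff (\<Sum>i<N. smult (coeff p i) (monom 1 i)) k = (\<Sum>i<N. if k = i then coeff p i else 0)"
    by (simp add: coeff_sum if_distrib cong: if_cong)
  also have "\<dots> = coeff p k"
    using assms by (auto simp: deg_lt_def)
  finally show "coeff p k = coeff (\<Sum>i<N. smult (coeff p i) (monom 1 i)) k" ..
qed

section \<open>Functionals with normal indices: dual bases, uniqueness, reproducing kernel\<close>

text \<open>Linearity is asked on polynomials only: for other arguments the integrals behind
  \<open>L\<close> need not exist.\<close>

locale normal_functionals =
  fixes r :: nat and L :: "nat \<Rightarrow> (complex \<Rightarrow> complex) \<Rightarrow> complex"
  assumes L_add: "j \<in> {1..r} \<Longrightarrow> L j (poly (p + q)) = L j (poly p) + L j (poly q)"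
    and L_smult: "j \<in> {1..r} \<Longrightarrow> L j (poly (smult c p)) = c * L j (poly p)"
    and normal: "normal_index r L n"
begin

definition M :: "nat \<Rightarrow> complex poly \<Rightarrow> complex" where
  "M j p = L j (poly p)"

text \<open>The bilinear pairing in which type I conditions constrain the second argument and type
  II conditions the first; this makes the two kinds dual to each other.\<close>

definition S :: "complex poly \<Rightarrow> (nat \<Rightarrow> complex poly) \<Rightarrow> complex" where
  "S p B = (\<Sum>j=1..r. M j (p * B j))"

lemma M_add: "j \<in> {1..r} \<Longrightarrow> M j (p + q) = M j p + M j q"
  and M_smult: "j \<in> {1..r} \<Longrightarrow> M j (smult c p) = c * M j p"
  using L_add L_smult by (simp_all add: M_def)

lemma M_0 [simp]: "j \<in> {1..r} \<Longrightarrow> M j 0 = 0"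
  using M_smult[of j 0 0] by simp

lemma M_diff: "j \<in> {1..r} \<Longrightarrow> M j (p - q) = M j p - M j q"
  using M_add[of j p "smult (-1) q"] M_smult[of j "-1" q] by simp

lemma M_sum: "j \<in> {1..r} \<Longrightarrow> M j (\<Sum>i\<in>I. f i) = (\<Sum>i\<in>I. M j (f i))"
  by (induction I rule: infinite_finite_induct) (auto simp: M_add)

lemma L_eq_M:
  assumes "\<And>x. f x = poly p x"
  shows "L j f = M j p"
proof -
  have "f = poly p" using assms by (rule ext)
  then show ?thesis by (simp add: M_def)
qed

lemma S_cong: "(\<And>j. j \<in> {1..r} \<Longrightarrow> B j = C j) \<Longrightarrow> S p B = S p C"
  by (simp add: S_def)

lemma S_left_add: "S (p + q) B = S p B + S q B"
  by (simp add: S_def distrib_right M_add sum.distrib)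

lemma S_left_smult: "S (smult c p) B = c * S p B"
  by (simp add: S_def M_smult sum_distrib_left)

lemma S_left_sum: "S (\<Sum>i\<in>I. f i) B = (\<Sum>i\<in>I. S (f i) B)"
  by (simp add: S_def sum_distrib_right M_sum) (rule sum.swap)

lemma S_0 [simp]: "S 0 B = 0"
  by (simp add: S_def)

lemma S_diff: "S p (\<lambda>j. B j - C j) = S p B - S p C"
  by (simp add: S_def right_diff_distrib M_diff sum_subtractf)

lemma S_smult: "S p (\<lambda>j. smult c (B j)) = c * S p B"
  by (simp add: S_def M_smult sum_distrib_left)

lemma S_sum: "S p (\<lambda>j. \<Sum>i\<in>I. B i j) = (\<Sum>i\<in>I. S p (B i))"
  by (simp add: S_def sum_distrib_left M_sum) (rule sum.swap)

lemma S_left_expand: "deg_lt p N \<Longrightarrow> S p B = (\<Sum>i<N. coeff p i * S (monom 1 i) B)"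
  using deg_lt_sum_monom[of p N] S_left_sum[of "\<lambda>i. smult (coeff p i) (monom 1 i)" "{..<N}" B]
  by (simp only: S_left_smult)

lemma M_right_expand:
  assumes "j \<in> {1..r}" "deg_lt q N"
  shows "M j (p * q) = (\<Sum>s<N. coeff q s * M j (p * monom 1 s))"
proof -
  have "M j (p * q) = M j (\<Sum>s<N. smult (coeff q s) (p * monom 1 s))"
    using deg_lt_sum_monom[OF assms(2)]
    by (metis (no_types, lifting) mult_smult_right sum.cong sum_distrib_left)
  then show ?thesis
    using assms(1) by (simp only: M_sum M_smult)
qed

text \<open>Both bases are read off from the inverse \<open>B\<close> of the moment matrix: column
  \<open>i\<close> gives the coefficients of the vector \<open>b i\<close>, row
  \<open>(j, s)\<close> those of the polynomial \<open>q j s\<close>.\<close>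

lemma dual_bases:
  obtains b q where
    "\<And>i j. deg_lt (b i j) (n j)"
    "\<And>i i'. i < msize r n \<Longrightarrow> i' < msize r n \<Longrightarrow> S (monom 1 i) (b i') = (if i = i' then 1 else 0)"
    "\<And>j s. deg_lt (q j s) (msize r n)"
    "\<And>j s j' s'. j \<in> {1..r} \<Longrightarrow> s < n j \<Longrightarrow> j' \<in> {1..r} \<Longrightarrow> s' < n j' \<Longrightarrow>
       M j' (q j s * monom 1 s') = (if j = j' \<and> s = s' then 1 else 0)"
proof (rule normal_index_inverse[OF normal[of n]])
  fix B assume B:
    "\<And>i i'. i < msize r n \<Longrightarrow> i' < msize r n \<Longrightarrow>
       (\<Sum>j=1..r. \<Sum>s<n j. L j (\<lambda>x. x ^ (s + i)) * B j s i') = (if i = i' then 1 else 0)"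
    "\<And>j s j' s'. j \<in> {1..r} \<Longrightarrow> s < n j \<Longrightarrow> j' \<in> {1..r} \<Longrightarrow> s' < n j' \<Longrightarrow>
       (\<Sum>i<msize r n. B j s i * L j' (\<lambda>x. x ^ (s' + i))) = (if j = j' \<and> s = s' then 1 else 0)"
  have L_pow: "L j (\<lambda>x. x ^ k) = M j (monom 1 k)" for j k
    by (rule L_eq_M) (simp add: poly_monom)
  show thesis
  proof (rule that[of "\<lambda>i j. \<Sum>s<n j. smult (B j s i) (monom 1 s)"
        "\<lambda>j s. \<Sum>i<msize r n. smult (B j s i) (monom 1 i)"])
    fix i i' assume "i < msize r n" "i' < msize r n"
    then show "S (monom 1 i) (\<lambda>j. \<Sum>s<n j. smult (B j s i') (monom 1 s)) = (if i = i' then 1 else 0)"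
      by (subst B(1)[symmetric])
         (auto simp: S_def sum_distrib_left M_sum M_smult mult_monom L_pow add.commute mult.commute
           intro!: sum.cong)
  next
    fix j s j' s' assume *: "j \<in> {1..r}" "s < n j" "j' \<in> {1..r}" "s' < n j'"
    then show "M j' ((\<Sum>i<msize r n. smult (B j s i) (monom 1 i)) * monom 1 s')
        = (if j = j' \<and> s = s' then 1 else 0)"
      by (subst B(2)[OF *, symmetric])
         (auto simp: sum_distrib_right M_sum M_smult mult_monom L_pow add.commute intro!: sum.cong)
  qed (intro deg_lt_sum deg_lt_smult deg_lt_monom; simp)+
qed

text \<open>Pairing with \<open>q j s\<close> extracts the coefficient \<open>s\<close> of
  \<open>B j\<close>, and it gives 0 because \<open>q j s\<close> is a combination of monomials of
  degree less than \<open>msize r n\<close>.\<close>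

lemma type_I_vector_unique:
  assumes deg: "\<And>j. j \<in> {1..r} \<Longrightarrow> deg_lt (B j) (n j)"
    and orth: "\<And>i. i < msize r n \<Longrightarrow> S (monom 1 i) B = 0"
    and j: "j \<in> {1..r}"
  shows "B j = 0"
proof -
  obtain q where q: "\<And>j s. deg_lt (q j s) (msize r n)"
    "\<And>j s j' s'. j \<in> {1..r} \<Longrightarrow> s < n j \<Longrightarrow> j' \<in> {1..r} \<Longrightarrow> s' < n j' \<Longrightarrow>
       M j' (q j s * monom 1 s') = (if j = j' \<and> s = s' then 1 else 0)"
    using dual_bases[of n] by metis
  have "coeff (B j) s = 0" if s: "s < n j" for s
  proof -
    have "0 = S (q j s) B"
      using S_left_expand[OF q(1)] orth by simp
    also have "\<dots> = (\<Sum>j'=1..r. \<Sum>s'<n j'. coeff (B j') s' * M j' (q j s * monom 1 s'))"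
      unfolding S_def by (intro sum.cong refl M_right_expand deg)
    also have "\<dots> = (\<Sum>j'=1..r. \<Sum>s'<n j'. if j = j' \<and> s = s' then coeff (B j') s' else 0)"
      by (intro sum.cong refl) (simp add: q(2)[OF j s])
    also have "\<dots> = (\<Sum>j'=1..r. if j = j' then (\<Sum>s'<n j'. if s = s' then coeff (B j') s' else 0) else 0)"
      by (intro sum.cong) auto
    also have "\<dots> = coeff (B j) s"
      using j s by simp
    finally show ?thesis by simp
  qed
  then show ?thesis
    using deg[OF j] by (metis deg_lt_def leading_coeff_0_iff linorder_not_less)
qed

text \<open>Dually, pairing \<open>p\<close> with \<open>b k\<close> extracts the coefficient
  \<open>k\<close> of \<open>p\<close>.\<close>

lemma type_II_polynomial_unique:
  assumes deg: "deg_lt p (msize r n)"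
    and orth: "\<And>j s. j \<in> {1..r} \<Longrightarrow> s < n j \<Longrightarrow> M j (p * monom 1 s) = 0"
  shows "p = 0"
proof -
  obtain b where b: "\<And>i j. deg_lt (b i j) (n j)"
    "\<And>i i'. i < msize r n \<Longrightarrow> i' < msize r n \<Longrightarrow> S (monom 1 i) (b i') = (if i = i' then 1 else 0)"
    using dual_bases[of n] by metis
  have "coeff p k = 0" if k: "k < msize r n" for k
  proof -
    have "0 = S p (b k)"
      using M_right_expand[OF _ b(1)] orth by (simp add: S_def)
    also have "\<dots> = (\<Sum>i<msize r n. if i = k then coeff p i else 0)"
      unfolding S_left_expand[OF deg] using b(2)[OF _ k] by (intro sum.cong) auto
    finally show ?thesis using k by simp
  qed
  then show ?thesis
    using deg by (metis deg_lt_def leading_coeff_0_iff linorder_not_less)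
qed

text \<open>Weighting the dual vectors \<open>b i\<close> by the powers \<open>x ^ i\<close> turns
  the extraction of coefficients into evaluation at \<open>x\<close>.\<close>

lemma reproducing_kernel:
  obtains K where "\<And>j. deg_lt (K j) (n j)"
    "\<And>p. deg_lt p (msize r n) \<Longrightarrow> S p K = poly p x"
proof -
  obtain b where b: "\<And>i j. deg_lt (b i j) (n j)"
    "\<And>i i'. i < msize r n \<Longrightarrow> i' < msize r n \<Longrightarrow> S (monom 1 i) (b i') = (if i = i' then 1 else 0)"
    using dual_bases[of n] by metis
  define K where "K = (\<lambda>j. \<Sum>i<msize r n. smult (x ^ i) (b i j))"
  show thesis
  proof (rule that[of K])
    show "deg_lt (K j) (n j)" for j
      unfolding K_def by (intro deg_lt_sum deg_lt_smult b)
    fix p :: "complex poly" assume p: "deg_lt p (msize r n)"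
    have "S (monom 1 i) K = x ^ i" if "i < msize r n" for i
    proof -
      have "S (monom 1 i) K = (\<Sum>i'<msize r n. if i = i' then x ^ i' else 0)"
        unfolding K_def S_sum S_smult using b(2) that by (intro sum.cong) auto
      then show ?thesis using that by simp
    qed
    then have "S p K = (\<Sum>i<msize r n. coeff p i * x ^ i)"
      unfolding S_left_expand[OF p] by simp
    also have "\<dots> = poly p x"
      by (subst (2) deg_lt_sum_monom[OF p]) (simp add: poly_sum poly_monom)
    finally show "S p K = poly p x" .
  qed
qed

section \<open>Existence of the type I and type II polynomials\<close>

lemma is_type_I_iff:
  "is_type_I r L n A \<longleftrightarrow>
     (\<forall>j\<in>{1..r}. deg_lt (A j) (n j)) \<and> (\<forall>j. j \<notin> {1..r} \<longrightarrow> A j = 0) \<and>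
     (\<forall>i<msize r n. S (monom 1 i) A = (if i = msize r n - 1 then 1 else 0))"
proof -
  have L_S: "(\<Sum>j=1..r. L j (\<lambda>x. x ^ k * poly (A j) x)) = S (monom 1 k) A" for k
    unfolding S_def by (intro sum.cong refl L_eq_M) (simp add: poly_monom)
  have deg: "(if n j = 0 then A j = 0 else degree (A j) \<le> n j - 1) \<longleftrightarrow> deg_lt (A j) (n j)" for j
    by (auto simp: deg_lt_iff)
  \<comment> \<open>For \<open>N = 0\<close> both sides are vacuous, so the truncated difference
    \<open>N - 1\<close> is harmless.\<close>
  have orth: "(\<forall>k. k + 2 \<le> N \<longrightarrow> f k = 0) \<and> (1 \<le> N \<longrightarrow> f (N - 1) = 1) \<longleftrightarrow>
      (\<forall>i<N. f i = (if i = N - 1 then 1 else 0))" for N and f :: "nat \<Rightarrow> complex"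
  proof (cases N)
    case (Suc N')
    then show ?thesis by (auto simp: less_Suc_eq)
  qed simp
  show ?thesis
    unfolding is_type_I_def L_S deg
    using orth[of "msize r n" "\<lambda>k. S (monom 1 k) A"] by blast
qed

lemma type_I_is_type_I: "is_type_I r L n (type_I r L n)"
  unfolding type_I_def
proof (rule theI'[of "is_type_I r L n"])
  obtain b where b: "\<And>i j. deg_lt (b i j) (n j)"
    "\<And>i i'. i < msize r n \<Longrightarrow> i' < msize r n \<Longrightarrow> S (monom 1 i) (b i') = (if i = i' then 1 else 0)"
    using dual_bases[of n] by metis
  \<comment> \<open>The vector dual to the highest monomial is the type I vector. It is set to 0
    outside \<open>{1..r}\<close> because uniqueness concerns \<open>A\<close> as a total
    function.\<close>
  define A where "A = (\<lambda>j. if j \<in> {1..r} then b (msize r n - 1) j else 0)"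
  have "is_type_I r L n A"
    using b S_cong[of A "b (msize r n - 1)"] by (auto simp: is_type_I_iff A_def)
  moreover have "A' = A" if A': "is_type_I r L n A'" for A'
  proof
    fix j
    show "A' j = A j"
    proof (cases "j \<in> {1..r}")
      case True
      then have "A' j - A j = 0"
        using A' \<open>is_type_I r L n A\<close>
        by (intro type_I_vector_unique[of "\<lambda>j. A' j - A j" n]) (auto simp: is_type_I_iff S_diff intro!: deg_lt_diff)
      then show ?thesis by simp
    qed (use A' \<open>is_type_I r L n A\<close> in \<open>simp add: is_type_I_iff\<close>)
  qed
  ultimately show "\<exists>!A. is_type_I r L n A" by auto
qed

text \<open>Expressing monicity by a degree bound makes all conditions affine, so two solutions
  differ by a polynomial covered by the uniqueness lemma.\<close>

lemma is_type_II_iff: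
  "is_type_II r L n p \<longleftrightarrow>
     deg_lt (p - monom 1 (msize r n)) (msize r n) \<and> (\<forall>j\<in>{1..r}. \<forall>k<n j. M j (p * monom 1 k) = 0)"
proof -
  have "lead_coeff p = 1 \<and> degree p = N \<longleftrightarrow> deg_lt (p - monom 1 N) N" for N
  proof
    assume *: "deg_lt (p - monom 1 N) N"
    then have "coeff p i = 0" if "i > N" for i
      using that by (simp add: deg_lt_def)
    moreover have "coeff p N = 1"
      using * by (force simp: deg_lt_def)
    ultimately have "degree p = N"
      by (metis degree_le le_degree order_antisym zero_neq_one)
    then show "lead_coeff p = 1 \<and> degree p = N"
      using \<open>coeff p N = 1\<close> by simp
  qed (auto simp: deg_lt_def coeff_eq_0)
  moreover have "L j (\<lambda>x. poly p x * x ^ k) = M j (p * monom 1 k)" for j k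
    by (rule L_eq_M) (simp add: poly_monom)
  ultimately show ?thesis
    by (simp add: is_type_II_def conj_assoc[symmetric])
qed

lemma type_II_is_type_II: "is_type_II r L n (type_II r L n)"
  unfolding type_II_def
proof (rule theI'[of "is_type_II r L n"])
  obtain q where q: "\<And>j s. deg_lt (q j s) (msize r n)"
    "\<And>j s j' s'. j \<in> {1..r} \<Longrightarrow> s < n j \<Longrightarrow> j' \<in> {1..r} \<Longrightarrow> s' < n j' \<Longrightarrow>
       M j' (q j s * monom 1 s') = (if j = j' \<and> s = s' then 1 else 0)"
    using dual_bases[of n] by metis
  define N where "N = msize r n"
  \<comment> \<open>Subtracting the combination of the \<open>q j s\<close> with the same mixed
    moments makes the leading monomial orthogonal without changing its leading term.\<close>
  define p where "p = monom 1 N - (\<Sum>j=1..r. \<Sum>s<n j. smult (M j (monom 1 N * monom 1 s)) (q j s))"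
  have "M k (p * monom 1 t) = 0" if kt: "k \<in> {1..r}" "t < n k" for k t
  proof -
    have "M k (p * monom 1 t) = M k (monom 1 N * monom 1 t)
        - (\<Sum>j=1..r. \<Sum>s<n j. M j (monom 1 N * monom 1 s) * M k (q j s * monom 1 t))"
      using kt(1) by (simp add: p_def left_diff_distrib sum_distrib_right M_diff M_sum M_smult)
    also have "(\<Sum>j=1..r. \<Sum>s<n j. M j (monom 1 N * monom 1 s) * M k (q j s * monom 1 t))
        = (\<Sum>j=1..r. \<Sum>s<n j. if j = k \<and> s = t then M j (monom 1 N * monom 1 s) else 0)"
      by (intro sum.cong refl) (simp add: q(2)[OF _ _ kt])
    also have "\<dots> = (\<Sum>j=1..r. if j = k then (\<Sum>s<n j. if s = t then M j (monom 1 N * monom 1 s) else 0) else 0)"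
      by (intro sum.cong) auto
    also have "\<dots> = M k (monom 1 N * monom 1 t)"
      using kt by simp
    finally show ?thesis by simp
  qed
  moreover have "deg_lt (p - monom 1 N) N"
  proof -
    have "deg_lt (\<Sum>j=1..r. \<Sum>s<n j. smult (M j (monom 1 N * monom 1 s)) (q j s)) N"
      unfolding N_def by (intro deg_lt_sum deg_lt_smult q)
    then show ?thesis
      using deg_lt_diff[OF deg_lt_0] by (force simp: p_def)
  qed
  ultimately have p: "is_type_II r L n p"
    by (simp add: is_type_II_iff N_def)
  moreover have "p' = p" if p': "is_type_II r L n p'" for p'
  proof -
    have "deg_lt (p' - p) (msize r n)"
      using deg_lt_diff[of "p' - monom 1 (msize r n)" "msize r n" "p - monom 1 (msize r n)"] p p'
      by (simp add: is_type_II_iff)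
    then have "p' - p = 0"
      using p p' by (intro type_II_polynomial_unique) (auto simp: is_type_II_iff left_diff_distrib M_diff)
    then show ?thesis by simp
  qed
  ultimately show "\<exists>!p. is_type_II r L n p" by auto
qed

section \<open>Orthogonality relations and the Christoffel-Darboux formula\<close>

abbreviation "N \<equiv> msize r"
abbreviation "A \<equiv> type_I r L"
abbreviation "P \<equiv> type_II r L"

lemma deg_lt_type_I: "j \<in> {1..r} \<Longrightarrow> deg_lt (A n j) (n j)"
  using type_I_is_type_I by (simp add: is_type_I_iff)

lemma S_type_I:
  assumes "deg_lt p (N n)"
  shows "S p (A n) = coeff p (N n - 1)"
proof (cases "N n = 0")
  case True
  then have "p = 0" using assms by (simp add: deg_lt_iff)
  then show ?thesis by simp
next
  case False
  have "S p (A n) = (\<Sum>i<N n. if i = N n - 1 then coeff p i else 0)"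
    unfolding S_left_expand[OF assms] using type_I_is_type_I[of n]
    by (intro sum.cong) (auto simp: is_type_I_iff)
  then show ?thesis using False by simp
qed

lemma type_II_monic: "deg_lt (P n - monom 1 (N n)) (N n)"
  and M_type_II_monom: "j \<in> {1..r} \<Longrightarrow> k < n j \<Longrightarrow> M j (P n * monom 1 k) = 0"
  using type_II_is_type_II[of n] by (simp_all add: is_type_II_iff)

lemma deg_lt_type_II: "deg_lt (P n) (Suc (N n))"
  using type_II_monic[of n] by (auto simp: deg_lt_def)

lemma coeff_type_II: "coeff (P n) (N n) = 1"
  using type_II_monic[of n] by (force simp: deg_lt_def)

lemma M_type_II:
  assumes "j \<in> {1..r}" "deg_lt q (Suc (n j))"
  shows "M j (P n * q) = coeff q (n j) * M j (P n * monom 1 (n j))"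
  using M_type_II_monom[OF assms(1)] by (simp add: M_right_expand[OF assms])

lemma M_type_II_0: "j \<in> {1..r} \<Longrightarrow> deg_lt q (n j) \<Longrightarrow> M j (P n * q) = 0"
  using M_type_II[of j q n] deg_lt_mono[of q "n j" "Suc (n j)"] by (simp add: deg_lt_def)

text \<open>Orthogonality removes everything of degree less than \<open>n j\<close> in each
  component \<open>j\<close>; only component \<open>k\<close> may have one degree more.\<close>

lemma S_type_II_add_unit:
  assumes k: "k \<in> {1..r}" and B: "\<And>j. j \<in> {1..r} \<Longrightarrow> deg_lt (B j) (add_unit n k j)"
  shows "S (P n) B = coeff (B k) (n k) * M k (P n * monom 1 (n k))"
proof -
  have "M j (P n * B j) = (if j = k then coeff (B k) (n k) * M k (P n * monom 1 (n k)) else 0)"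
    if "j \<in> {1..r}" for j
    using B[OF that] M_type_II[OF that, of "B j" n] M_type_II_0[OF that, of "B j" n]
    by (auto simp: add_unit_def)
  then show ?thesis
    using k by (simp add: S_def)
qed

lemma msize_add_unit: "j \<in> {1..r} \<Longrightarrow> N (add_unit n j) = Suc (N n)"
  by (simp add: msize_def add_unit_def sum.remove[of _ j])

lemma add_unit_sub_unit: "1 \<le> n j \<Longrightarrow> add_unit (sub_unit n j) j = n"
  by (auto simp: add_unit_def sub_unit_def)

lemma msize_sub_unit: "j \<in> {1..r} \<Longrightarrow> 1 \<le> n j \<Longrightarrow> Suc (N (sub_unit n j)) = N n"
  using msize_add_unit[of j "sub_unit n j"] by (simp add: add_unit_sub_unit)

text \<open>The pairing of \<open>P n\<close> with \<open>A (add_unit n k)\<close> is computed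
  twice: the type I normalization gives the leading coefficient 1, type II orthogonality leaves one
  product. In particular, the denominators of the recurrence coefficients are nonzero.\<close>

lemma M_type_II_leading:
  assumes "k \<in> {1..r}"
  shows "coeff (A (add_unit n k) k) (n k) * M k (P n * monom 1 (n k)) = 1"
  using S_type_II_add_unit[OF assms, of "A (add_unit n k)" n] assms
    S_type_I[of "P n" "add_unit n k"]
  by (simp add: deg_lt_type_I deg_lt_type_II msize_add_unit coeff_type_II)

lemma rec_coeff_eq:
  "rec_coeff r L n j = M j (P n * monom 1 (n j)) / M j (P (sub_unit n j) * monom 1 (n j - 1))"
proof -
  have "L j (\<lambda>x. x ^ k * poly p x) = M j (p * monom 1 k)" for k p
    by (rule L_eq_M) (simp add: poly_monom)
  then show ?thesis by (simp add: rec_coeff_def)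
qed

lemma christoffel_darboux:
  assumes n: "\<And>j. j \<in> {1..r} \<Longrightarrow> 1 \<le> n j"
    and r: "1 \<le> r"
    and K: "\<And>j. deg_lt (K j) (n j)" "\<And>p. deg_lt p (N n) \<Longrightarrow> S p K = poly p x"
    and k: "k \<in> {1..r}"
  shows "[:x, -1:] * K k = smult (poly (P n) x) (A n k)
    - (\<Sum>j=1..r. smult (rec_coeff r L n j * poly (P (sub_unit n j)) x) (A (add_unit n j) k))"
proof -
  \<comment> \<open>The coefficients of \<open>t ^ n k\<close> cancel in \<open>D k\<close>, so that \<open>D\<close> has the degrees of a type I vector for
    \<open>n\<close>; being orthogonal to all polynomials of degree less than \<open>N n\<close>, it vanishes.\<close>
  let ?c = "\<lambda>j. rec_coeff r L n j * poly (P (sub_unit n j)) x"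
  define T where "T = (\<lambda>k. \<Sum>j=1..r. smult (?c j) (A (add_unit n j) k))"
  define D where "D = (\<lambda>k. [:x, -1:] * K k - (smult (poly (P n) x) (A n k) - T k))"
  have pos: "N n \<ge> 1"
    using n[of 1] msize_sub_unit[of 1 n] r by simp
  \<comment> \<open>Here \<open>?h\<close> is the denominator of the recurrence coefficient.
    Reproducing \<open>P ?m\<close> at \<open>x\<close> gives the top coefficient of
    \<open>K j\<close> times \<open>?h\<close>, and the numerator is the reciprocal of the top
    coefficient of \<open>A (add_unit n j) j\<close>.\<close>
  have lead: "?c j * coeff (A (add_unit n j) j) (n j) = coeff (K j) (n j - 1)" if j: "j \<in> {1..r}" for j
  proof -
    let ?m = "sub_unit n j" and ?h = "M j (P (sub_unit n j) * monom 1 (n j - 1))"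
    have "?m j = n j - 1" by (simp add: sub_unit_def)
    then have "?h \<noteq> 0"
      using M_type_II_leading[OF j, of ?m] by (metis mult_not_zero zero_neq_one)
    have "deg_lt (P ?m) (N n)"
      using deg_lt_type_II[of ?m] msize_sub_unit[OF j, of n] n[OF j] by simp
    then have "poly (P ?m) x = S (P ?m) K"
      using K(2) by simp
    also have "\<dots> = coeff (K j) (n j - 1) * ?h"
      using S_type_II_add_unit[OF j, of K ?m] K(1) \<open>?m j = n j - 1\<close> add_unit_sub_unit[of n j] n[OF j]
      by (simp del: One_nat_def)
    finally show ?thesis
      using M_type_II_leading[OF j, of n] \<open>?h \<noteq> 0\<close>
      by (simp add: rec_coeff_eq mult_ac)
  qed
  have "deg_lt (D k) (n k)" if k: "k \<in> {1..r}" for k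
  proof -
    \<comment> \<open>Raising the index at \<open>j\<close> relaxes the degree bound in component
      \<open>j\<close> only, so in component \<open>k\<close> a coefficient of order
      \<open>n k\<close> can come only from \<open>j = k\<close>.\<close>
    have A: "coeff (A (add_unit n j) k) i = 0" if "j \<in> {1..r}" "i \<ge> n k" "j \<noteq> k \<or> i > n k" for i j
      using deg_lt_type_I[OF k, of "add_unit n j"] that by (auto simp: deg_lt_def add_unit_def split: if_splits)
    have "coeff (D k) i = 0" if i: "i \<ge> n k" for i
    proof -
      have "coeff (T k) i = (\<Sum>j=1..r. if j = k then ?c k * coeff (A (add_unit n k) k) i else 0)"
        unfolding T_def coeff_sum coeff_smult using A[OF _ i] by (intro sum.cong) auto
      also have "\<dots> = (if i = n k then coeff (K k) (n k - 1) else 0)"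
        using k A[OF k i] i lead[OF k] by auto
      finally show ?thesis
        using i n[OF k] K(1)[of k] deg_lt_type_I[OF k, of n]
        by (auto simp: D_def coeff_pCons deg_lt_def split: nat.splits)
    qed
    then show ?thesis by (simp add: deg_lt_def)
  qed
  moreover have "S (monom 1 i) D = 0" if i: "i < N n" for i
  proof -
    \<comment> \<open>The type I vectors in \<open>T\<close> have size \<open>N n + 1\<close>, so
      their normalization is met only at the exponent \<open>N n\<close>, which exceeds
      \<open>i\<close>.\<close>
    have "S (monom 1 i) T = 0"
    proof -
      have "S (monom 1 i) (A (add_unit n j)) = 0" if "j \<in> {1..r}" for j
        using S_type_I[of "monom 1 i" "add_unit n j"] i that
        by (simp add: msize_add_unit deg_lt_monom)
      then show ?thesis
        unfolding T_def S_sum S_smult by simp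
    qed
    moreover have "S (monom 1 i) (\<lambda>k. [:x, -1:] * K k) = poly (P n) x * S (monom 1 i) (A n)"
    proof -
      have *: "S (monom 1 i) (\<lambda>k. [:x, -1:] * K k) = S (monom 1 i * [:x, -1:]) K"
        by (simp only: S_def mult.assoc)
      define q where "q = monom 1 i * [:x, -1:]"
      have coeff_q: "coeff q l = (if l = i then x else 0) - (if l = Suc i then 1 else 0)" for l
        by (auto simp: q_def coeff_pCons monom_altdef[symmetric] mult.commute[of "monom 1 i"] split: nat.splits)
      have poly_q: "poly q x = 0"
        by (simp add: q_def)
      show ?thesis
      proof (cases "Suc i = N n")
        case True
        \<comment> \<open>In this case \<open>q\<close> has degree \<open>N n\<close>, just outside
          the reach of the kernel. Its leading coefficient is -1, so adding the monic
          \<open>P n\<close> lowers the degree, and \<open>P n\<close> pairs to 0 with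
          \<open>K\<close>.\<close>
        have "deg_lt (q + P n) (N n)"
          unfolding deg_lt_def
        proof (intro allI impI)
          fix l assume "N n \<le> l"
          then show "coeff (q + P n) l = 0"
            using True deg_lt_type_II[of n] coeff_type_II[of n]
            by (cases "l = N n") (auto simp: coeff_q deg_lt_def)
        qed
        then have "S q K + S (P n) K = poly (P n) x"
          using K(2) poly_q by (simp add: S_left_add[symmetric])
        moreover have "S (P n) K = 0"
          using K(1) by (simp add: S_def M_type_II_0)
        moreover have "S (monom 1 i) (A n) = 1"
          using S_type_I[OF deg_lt_monom[OF i], where c1=1] True by auto
        ultimately show ?thesis
          unfolding * q_def[symmetric] by simp
      next
        case False
        then have "deg_lt q (N n)"
          using i by (auto simp: deg_lt_def coeff_q)
        then show ?thesis
          unfolding * q_def[symmetric]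
          using K(2) poly_q S_type_I[OF deg_lt_monom[OF i], of 1] False i by auto
      qed
    qed
    ultimately show ?thesis
      unfolding D_def by (simp add: S_diff S_smult)
  qed
  ultimately have "D k = 0"
    using type_I_vector_unique[of D n] k by blast
  then show ?thesis
    by (simp add: D_def T_def)
qed

end

section \<open>Integrating a derivative that may fail to exist at zeros\<close>

text \<open>Such a zero is isolated among the zeros of \<open>f\<close>, and a rational interval
  containing no other zero identifies it.\<close>

lemma countable_zeros_nonzero_derivative:
  fixes f :: "real \<Rightarrow> 'a::real_normed_vector"
  shows "countable {s. f s = 0 \<and> (\<exists>D. D \<noteq> 0 \<and> (f has_vector_derivative D) (at s))}"
    (is "countable ?Z")
proof -
  have "\<forall>s\<in>?Z. \<exists>p::rat \<times> rat. of_rat (fst p) < s \<and> s < of_rat (snd p) \<and>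
      (\<forall>t. of_rat (fst p) < t \<and> t < of_rat (snd p) \<and> f t = 0 \<longrightarrow> t = s)"
  proof
    fix s assume s: "s \<in> ?Z"
    obtain D where D: "f s = 0" "D \<noteq> 0"
        "((\<lambda>t. norm (f t - (t - s) *\<^sub>R D) / \<bar>t - s\<bar>) \<longlongrightarrow> 0) (at s)"
      using s by (auto simp: has_vector_derivative_def has_derivative_iff_norm)
    have "\<forall>\<^sub>F t in at s. norm (f t - (t - s) *\<^sub>R D) / \<bar>t - s\<bar> < norm D"
      using order_tendstoD(2)[OF D(3)] D(2) by simp
    then obtain e where e: "e > 0"
      "\<And>t. t \<noteq> s \<Longrightarrow> \<bar>t - s\<bar> < e \<Longrightarrow> norm (f t - (t - s) *\<^sub>R D) / \<bar>t - s\<bar> < norm D"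
      by (auto simp: eventually_at dist_real_def)
    \<comment> \<open>At another zero \<open>t\<close> the quotient in \<open>e(2)\<close> would
      equal \<open>norm D\<close>.\<close>
    have e2: "f t \<noteq> 0" if "t \<noteq> s" "\<bar>t - s\<bar> < e" for t
      using e(2)[OF that] that by auto
    obtain p q where "s - e < of_rat p" "of_rat p < s" "s < of_rat q" "of_rat q < s + e"
      using of_rat_dense[of "s - e" s] of_rat_dense[of s "s + e"] \<open>e > 0\<close> by auto
    then show "\<exists>p::rat \<times> rat. of_rat (fst p) < s \<and> s < of_rat (snd p) \<and>
        (\<forall>t. of_rat (fst p) < t \<and> t < of_rat (snd p) \<and> f t = 0 \<longrightarrow> t = s)"
      using e2 by (intro exI[of _ "(p, q)"]) force
  qed
  from bchoice[OF this] obtain g :: "real \<Rightarrow> rat \<times> rat" where g: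
    "\<forall>s\<in>?Z. of_rat (fst (g s)) < s \<and> s < of_rat (snd (g s)) \<and>
      (\<forall>t. of_rat (fst (g s)) < t \<and> t < of_rat (snd (g s)) \<and> f t = 0 \<longrightarrow> t = s)" ..
  have "inj_on g ?Z"
  proof (rule inj_onI)
    fix s t assume st: "s \<in> ?Z" "t \<in> ?Z" "g s = g t"
    then show "s = t" using bspec[OF g st(1)] bspec[OF g st(2)] by auto
  qed
  then show ?thesis
    by (rule countableI')
qed

text \<open>
  A continuously differentiable function that vanishes near \<open>0\<close> and tends to the identity as
  \<open>e \<longlonglongrightarrow> 0\<close>, with a derivative bounded uniformly in \<open>e\<close>. If \<open>f\<close> is continuous, then
  \<open>trunc e \<circ> f\<close> is differentiable also at the zeros of \<open>f\<close>.
\<close>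
definition trunc :: "real \<Rightarrow> real \<Rightarrow> real" where
  "trunc e y = (max 0 (y\<^sup>2 - e\<^sup>2))\<^sup>2 * y / (y\<^sup>2 + e\<^sup>2)\<^sup>2"

text \<open>Both summands are homogeneous of degree 0 in \<open>(e, y)\<close>, which is the source
  of the bound uniform in \<open>e\<close>.\<close>

definition trunc_deriv :: "real \<Rightarrow> real \<Rightarrow> real" where
  "trunc_deriv e y = 4 * max 0 (y\<^sup>2 - e\<^sup>2) * y\<^sup>2 / (y\<^sup>2 + e\<^sup>2)\<^sup>2
     + (max 0 (y\<^sup>2 - e\<^sup>2))\<^sup>2 * (e\<^sup>2 - 3 * y\<^sup>2) / (y\<^sup>2 + e\<^sup>2) ^ 3"

text \<open>Squaring smooths the corner of \<open>max 0\<close>, so that \<open>trunc e\<close> is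
  differentiable also at \<plusminus>\<open>e\<close>.\<close>

lemma has_real_derivative_max_squared:
  "((\<lambda>u. (max 0 u)\<^sup>2) has_real_derivative 2 * max 0 u) (at (u::real))"
proof -
  consider "u < 0" | "u > 0" | "u = 0" by linarith
  then show ?thesis
  proof cases
    case 1
    have "((\<lambda>u. (max 0 u)\<^sup>2) has_real_derivative 0) (at u)"
      by (rule has_field_derivative_transform_within_open[where f="\<lambda>_. 0" and S="{..<0}"])
         (use 1 in auto)
    then show ?thesis using 1 by simp
  next
    case 2
    have "((\<lambda>u. (max 0 u)\<^sup>2) has_real_derivative 2 * u) (at u)"
      by (rule has_field_derivative_transform_within_open[where f="\<lambda>u. u\<^sup>2" and S="{0<..}"])
         (use 2 in \<open>auto intro!: derivative_eq_intros\<close>)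
    then show ?thesis using 2 by simp
  next
    case 3
    have "((\<lambda>h::real. (max 0 h)\<^sup>2 / h) \<longlongrightarrow> 0) (at 0)"
    proof (rule Lim_null_comparison)
      show "\<forall>\<^sub>F h in at 0. norm ((max 0 h)\<^sup>2 / h) \<le> \<bar>h\<bar>"
        by (auto simp: max_def power2_eq_square)
    qed (auto intro!: tendsto_eq_intros)
    then show ?thesis using 3 by (simp add: DERIV_def)
  qed
qed

lemma has_real_derivative_trunc:
  assumes "e > 0"
  shows "(trunc e has_real_derivative trunc_deriv e y) (at y)"
proof -
  have pos: "y\<^sup>2 + e\<^sup>2 > 0"
    using assms by (simp add: add_nonneg_pos)
  have "((\<lambda>y. (max 0 (y\<^sup>2 - e\<^sup>2))\<^sup>2) has_real_derivative 2 * max 0 (y\<^sup>2 - e\<^sup>2) * (2 * y)) (at y)"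
    by (rule DERIV_chain'[of "\<lambda>y. y\<^sup>2 - e\<^sup>2" "2 * y" y UNIV "\<lambda>u. (max 0 u)\<^sup>2", simplified])
       (use has_real_derivative_max_squared in \<open>auto intro!: derivative_eq_intros\<close>)
  note * = DERIV_divide[OF DERIV_mult[OF this DERIV_ident], of "\<lambda>y. (y\<^sup>2 + e\<^sup>2)\<^sup>2" "4 * y * (y\<^sup>2 + e\<^sup>2)"]
  have "((\<lambda>y. (y\<^sup>2 + e\<^sup>2)\<^sup>2) has_real_derivative 4 * y * (y\<^sup>2 + e\<^sup>2)) (at y)"
    by (auto intro!: derivative_eq_intros)
  note * = *[OF this]
  have eq: "((2 * M * (2 * y) * y + 1 * M\<^sup>2) * D\<^sup>2 - M\<^sup>2 * y * (4 * y * D)) / (D\<^sup>2 * D\<^sup>2)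
      = 4 * M * y\<^sup>2 / D\<^sup>2 + M\<^sup>2 * (D - 4 * y\<^sup>2) / D ^ 3" if "D \<noteq> 0" for M D :: real
    using that by (simp add: field_simps power2_eq_square power3_eq_cube)
  have ne: "(y\<^sup>2 + e\<^sup>2)\<^sup>2 \<noteq> 0" using assms by simp
  have "e\<^sup>2 - 3 * y\<^sup>2 = (y\<^sup>2 + e\<^sup>2) - 4 * y\<^sup>2" by simp
  then show ?thesis
    unfolding trunc_def[abs_def] trunc_deriv_def
    using DERIV_cong[OF *[OF ne] eq] assms by simp
qed

lemma trunc_eq_0: "\<bar>y\<bar> \<le> e \<Longrightarrow> trunc e y = 0"
  by (simp add: trunc_def abs_le_square_iff[symmetric] max_absorb1)

text \<open>The constant is 4 + 3: relative to \<open>y\<^sup>2 + e\<^sup>2\<close>, the factors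
  \<open>max 0 (y\<^sup>2 - e\<^sup>2)\<close> and \<open>y\<^sup>2\<close> are at most 1, and
  \<open>e\<^sup>2 - 3 * y\<^sup>2\<close> is at most 3 in absolute value.\<close>

lemma trunc_deriv_bound:
  assumes "e > 0"
  shows "\<bar>trunc_deriv e y\<bar> \<le> 7"
proof -
  define M where "M = max 0 (y\<^sup>2 - e\<^sup>2)"
  define D where "D = y\<^sup>2 + e\<^sup>2"
  have D: "D > 0" using assms by (simp add: D_def add_nonneg_pos)
  have M: "0 \<le> M" "M \<le> D" by (auto simp: M_def D_def)
  have y: "y\<^sup>2 \<le> D" "\<bar>e\<^sup>2 - 3 * y\<^sup>2\<bar> \<le> 3 * D"
    using zero_le_power2[of e] zero_le_power2[of y] by (simp_all add: D_def abs_le_iff)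
  have "\<bar>4 * M * y\<^sup>2 / D\<^sup>2\<bar> = 4 * (M / D) * (y\<^sup>2 / D)"
    using D M by (simp add: abs_mult power2_eq_square)
  also have "\<dots> \<le> 4 * 1 * 1"
    using D M y by (intro mult_mono) auto
  finally have 1: "\<bar>4 * M * y\<^sup>2 / D\<^sup>2\<bar> \<le> 4" by simp
  have "\<bar>M\<^sup>2 * (e\<^sup>2 - 3 * y\<^sup>2) / D ^ 3\<bar> = (M / D)\<^sup>2 * (\<bar>e\<^sup>2 - 3 * y\<^sup>2\<bar> / D)"
    using D M by (simp add: abs_mult power2_eq_square power3_eq_cube)
  also have "\<dots> \<le> 1 * 3"
    using D M y by (intro mult_mono) (auto simp: power_le_one divide_simps)
  finally have 2: "\<bar>M\<^sup>2 * (e\<^sup>2 - 3 * y\<^sup>2) / D ^ 3\<bar> \<le> 3" by simp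
  show ?thesis
    using 1 2 unfolding trunc_deriv_def M_def[symmetric] D_def[symmetric] by linarith
qed

lemma tendsto_trunc:
  assumes e: "e \<longlonglongrightarrow> 0"
  shows "(\<lambda>n. trunc (e n) y) \<longlonglongrightarrow> y"
proof (cases "y = 0")
  case False
  have "(\<lambda>n. trunc (e n) y) \<longlonglongrightarrow> (max 0 (y\<^sup>2 - 0\<^sup>2))\<^sup>2 * y / (y\<^sup>2 + 0\<^sup>2)\<^sup>2"
    unfolding trunc_def by (intro tendsto_intros e) (use False in auto)
  then show ?thesis using False by simp
qed (simp add: trunc_def)

lemma tendsto_trunc_deriv:
  assumes e: "e \<longlonglongrightarrow> 0" and "y \<noteq> 0"
  shows "(\<lambda>n. trunc_deriv (e n) y) \<longlonglongrightarrow> 1"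
proof -
  have "(\<lambda>n. trunc_deriv (e n) y) \<longlonglongrightarrow> 4 * max 0 (y\<^sup>2 - 0\<^sup>2) * y\<^sup>2 / (y\<^sup>2 + 0\<^sup>2)\<^sup>2
     + (max 0 (y\<^sup>2 - 0\<^sup>2))\<^sup>2 * (0\<^sup>2 - 3 * y\<^sup>2) / (y\<^sup>2 + 0\<^sup>2) ^ 3"
    unfolding trunc_deriv_def by (intro tendsto_intros e) (use \<open>y \<noteq> 0\<close> in auto)
  moreover have "4 * max 0 (y\<^sup>2 - 0\<^sup>2) * y\<^sup>2 / (y\<^sup>2 + 0\<^sup>2)\<^sup>2
     + (max 0 (y\<^sup>2 - 0\<^sup>2))\<^sup>2 * (0\<^sup>2 - 3 * y\<^sup>2) / (y\<^sup>2 + 0\<^sup>2) ^ 3 = 1"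
    using \<open>y \<noteq> 0\<close> by (simp add: field_simps power2_eq_square power3_eq_cube)
  ultimately show ?thesis by simp
qed

text \<open>The fundamental theorem applies to \<open>trunc (e n)\<close> composed with
  \<open>f\<close>; as \<open>e n\<close> tends to 0, dominated convergence with the bound
  \<open>7 * \<bar>h s\<bar>\<close> passes to the limit on both sides.\<close>

lemma has_integral_derivative_off_zeros:
  fixes f h :: "real \<Rightarrow> real"
  assumes cd: "c \<le> d" and cont: "continuous_on {c..d} f" and fin: "finite N"
    and der: "\<And>s. s \<in> {c<..<d} - N \<Longrightarrow> f s \<noteq> 0 \<Longrightarrow> (f has_real_derivative h s) (at s)"
    and h: "h absolutely_integrable_on {c..d}"
  shows "((\<lambda>s. if f s = 0 then 0 else h s) has_integral f d - f c) {c..d}"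
proof -
  define e where "e = (\<lambda>n. 1 / real (Suc n))"
  have e: "e n > 0" for n by (simp add: e_def)
  have e0: "e \<longlonglongrightarrow> 0"
    unfolding e_def using LIMSEQ_Suc[OF lim_1_over_n] by simp
  define g where "g = (\<lambda>n s. if f s = 0 then 0 else trunc_deriv (e n) (f s) * h s)"
  have int: "(g n has_integral trunc (e n) (f d) - trunc (e n) (f c)) {c..d}" for n
  proof (rule fundamental_theorem_of_calculus_interior_strong[OF fin cd])
    have "continuous_on UNIV (trunc (e n))"
      using has_real_derivative_trunc[OF e] DERIV_continuous_on by blast
    then show "continuous_on {c..d} (\<lambda>s. trunc (e n) (f s))"
      by (rule continuous_on_compose2[OF _ cont]) simp
  next
    fix s assume s: "s \<in> {c<..<d} - N"
    have "((\<lambda>s. trunc (e n) (f s)) has_real_derivative g n s) (at s)"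
    proof (cases "f s = 0")
      case False
      show ?thesis
        using DERIV_chain'[OF der[OF s False] has_real_derivative_trunc[OF e]] False
        by (simp add: g_def)
    next
      case True
      \<comment> \<open>By continuity \<open>f\<close> stays below \<open>e n\<close> near
        \<open>s\<close>, where \<open>trunc (e n)\<close> is 0; hence the derivative is 0 even if
        \<open>f\<close> has none at \<open>s\<close>.\<close>
      have "isCont f s"
        using cont s by (intro continuous_on_interior[OF cont]) (auto simp: interior_atLeastAtMost_real)
      then have "\<forall>\<^sub>F t in at s. \<bar>f t\<bar> < e n"
        using tendstoD[of f 0 "at s" "e n"] e True by (simp add: isCont_def dist_real_def)
      then have "\<forall>\<^sub>F t in nhds s. trunc (e n) (f t) = 0"
        using True e[of n] by (auto simp: eventually_at_filter trunc_eq_0 elim!: eventually_mono)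
      then show ?thesis
        using True DERIV_cong_ev[of s s "\<lambda>t. trunc (e n) (f t)" "\<lambda>_. 0" 0 0] by (simp add: g_def)
    qed
    then show "((\<lambda>s. trunc (e n) (f s)) has_vector_derivative g n s) (at s)"
      by (simp add: has_real_derivative_iff_has_vector_derivative)
  qed
  have "(\<lambda>s. \<bar>h s\<bar>) integrable_on {c..d}"
    using h by (simp add: absolutely_integrable_on_def)
  from integrable_cmul[OF this, of 7] have bound: "(\<lambda>s. 7 * \<bar>h s\<bar>) integrable_on {c..d}"
    by simp
  show ?thesis
  proof (rule has_integral_dominated_convergence[OF int bound])
    show "\<forall>s\<in>{c..d}. norm (g n s) \<le> 7 * \<bar>h s\<bar>" for n
      using mult_right_mono[OF trunc_deriv_bound[OF e]] by (simp add: g_def abs_mult)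
    show "\<forall>s\<in>{c..d}. (\<lambda>n. g n s) \<longlonglongrightarrow> (if f s = 0 then 0 else h s)"
      using tendsto_mult_right[OF tendsto_trunc_deriv[OF e0]] by (auto simp: g_def)
    show "(\<lambda>n. trunc (e n) (f d) - trunc (e n) (f c)) \<longlonglongrightarrow> f d - f c"
      by (intro tendsto_diff tendsto_trunc e0)
  qed
qed

text \<open>At a zero of \<open>f\<close> outside \<open>N\<close> and the end points,
  \<open>h\<close> can be nonzero only if it is a nonzero derivative of \<open>f\<close>. This
  happens countably often, so setting \<open>h\<close> to 0 at the zeros preserves the
  integral.\<close>

lemma has_integral_derivative_or_zero_real:
  fixes f h :: "real \<Rightarrow> real"
  assumes cd: "c \<le> d" and cont: "continuous_on {c..d} f" and fin: "finite N"
    and der: "\<And>s. s \<in> {c<..<d} - N \<Longrightarrow> (f has_real_derivative h s) (at s) \<or> h s = 0 \<and> f s = 0"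
    and h: "h absolutely_integrable_on {c..d}"
  shows "(h has_integral f d - f c) {c..d}"
proof (rule has_integral_spike)
  let ?Z = "{s. f s = 0 \<and> (\<exists>D. D \<noteq> 0 \<and> (f has_vector_derivative D) (at s))}"
  have "countable (?Z \<union> (N \<union> {c, d}))"
    using countable_zeros_nonzero_derivative[of f] fin by (auto intro: countable_finite)
  then show "negligible (?Z \<union> (N \<union> {c, d}))"
    unfolding negligible_iff_null_sets
    by (intro null_sets_completionI countable_imp_null_set_lborel)
  show "((\<lambda>s. if f s = 0 then 0 else h s) has_integral f d - f c) {c..d}"
    using assms by (intro has_integral_derivative_off_zeros) blast+
  show "h s = (if f s = 0 then 0 else h s)" if "s \<in> {c..d} - (?Z \<union> (N \<union> {c, d}))" for s
    using that der[of s] by (auto simp: has_real_derivative_iff_has_vector_derivative)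
qed

text \<open>The hypothesis passes to real and imaginary parts, since a common zero of
  \<open>f\<close> and \<open>h\<close> is one of their components.\<close>

lemma has_integral_derivative_or_zero:
  fixes f h :: "real \<Rightarrow> complex"
  assumes cd: "c \<le> d" and cont: "continuous_on {c..d} f" and fin: "finite N"
    and der: "\<And>s. s \<in> {c<..<d} - N \<Longrightarrow> (f has_vector_derivative h s) (at s) \<or> h s = 0 \<and> f s = 0"
    and h: "h absolutely_integrable_on {c..d}"
  shows "(h has_integral f d - f c) {c..d}"
proof -
  have *: "((\<lambda>s. h s \<bullet> u) has_integral f d \<bullet> u - f c \<bullet> u) {c..d}" for u
  proof (rule has_integral_derivative_or_zero_real[OF cd _ fin])
    show "continuous_on {c..d} (\<lambda>s. f s \<bullet> u)"
      by (intro continuous_intros cont)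
    show "((\<lambda>s. f s \<bullet> u) has_real_derivative h s \<bullet> u) (at s) \<or> h s \<bullet> u = 0 \<and> f s \<bullet> u = 0"
      if "s \<in> {c<..<d} - N" for s
      using der[OF that] bounded_linear.has_vector_derivative[OF bounded_linear_inner_left, of f "h s" "at s" u]
      by (auto simp: has_real_derivative_iff_has_vector_derivative)
    show "(\<lambda>s. h s \<bullet> u) absolutely_integrable_on {c..d}"
      using absolutely_integrable_linear[OF h bounded_linear_inner_left, of u] by (simp add: o_def)
  qed
  then show ?thesis
    by (subst has_integral_componentwise_iff) (simp add: inner_diff_left)
qed

section \<open>Weights on a curve\<close>

lemma einterval_obtain_Icc:
  assumes "s \<in> einterval a b"
  obtains c d where "a < ereal c" "c < s" "s < d" "ereal d < b"
proof -
  have *: "a < ereal s" "ereal s < b"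
    using assms by (auto simp: einterval_def)
  obtain c where "a < ereal c" "ereal c < ereal s" using ereal_dense2[OF *(1)] by blast
  moreover obtain d where "ereal s < ereal d" "ereal d < b" using ereal_dense2[OF *(2)] by blast
  ultimately show thesis using that by simp
qed

text \<open>Converts a limit along the end filter into one along the end points of compact intervals
  exhausting the parameter interval.\<close>

lemma tendsto_lower_end:
  assumes f: "(f \<longlongrightarrow> L) (lower_end a)" and l: "(\<lambda>i. ereal (l i)) \<longlonglongrightarrow> a" "\<And>i. a < ereal (l i)"
  shows "(\<lambda>i. f (l i)) \<longlonglongrightarrow> L"
proof -
  have "filterlim (\<lambda>i. ereal (l i)) (at_right a) sequentially"
    using l less_imp_neq[OF l(2)] by (auto simp: filterlim_at intro!: always_eventually)
  moreover have "((\<lambda>x. f (real_of_ereal x)) \<longlongrightarrow> L) (at_right a)"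
    using f by (simp add: lower_end_def filterlim_filtermap)
  ultimately show ?thesis
    by (auto dest: filterlim_compose)
qed

lemma tendsto_upper_end:
  assumes f: "(f \<longlongrightarrow> L) (upper_end b)" and u: "(\<lambda>i. ereal (u i)) \<longlonglongrightarrow> b" "\<And>i. ereal (u i) < b"
  shows "(\<lambda>i. f (u i)) \<longlonglongrightarrow> L"
proof -
  have "filterlim (\<lambda>i. ereal (u i)) (at_left b) sequentially"
    using u less_imp_neq[OF u(2)] by (auto simp: filterlim_at intro!: always_eventually)
  moreover have "((\<lambda>x. f (real_of_ereal x)) \<longlongrightarrow> L) (at_left b)"
    using f by (simp add: upper_end_def filterlim_filtermap)
  ultimately show ?thesis
    by (auto dest: filterlim_compose)
qed

lemma curve_integrable_add:
  assumes "curve_integrable a b \<gamma> f" "curve_integrable a b \<gamma> g"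
  shows "curve_integrable a b \<gamma> (\<lambda>t. f t + g t)"
    and "curve_integral a b \<gamma> (\<lambda>t. f t + g t) = curve_integral a b \<gamma> f + curve_integral a b \<gamma> g"
  unfolding curve_integrable_def curve_integral_def distrib_right
  by (rule interval_lebesgue_integral_add; fact assms[unfolded curve_integrable_def])+

lemma curve_integrable_diff:
  assumes "curve_integrable a b \<gamma> f" "curve_integrable a b \<gamma> g"
  shows "curve_integrable a b \<gamma> (\<lambda>t. f t - g t)"
    and "curve_integral a b \<gamma> (\<lambda>t. f t - g t) = curve_integral a b \<gamma> f - curve_integral a b \<gamma> g"
  unfolding curve_integrable_def curve_integral_def left_diff_distrib
  by (rule interval_lebesgue_integral_diff; fact assms[unfolded curve_integrable_def])+

lemma curve_integrable_cmult: "curve_integrable a b \<gamma> f \<Longrightarrow> curve_integrable a b \<gamma> (\<lambda>t. c * f t)"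
  and curve_integral_cmult: "curve_integral a b \<gamma> (\<lambda>t. c * f t) = c * curve_integral a b \<gamma> f"
  by (simp_all add: curve_integrable_def curve_integral_def mult.assoc)

lemma curve_integrable_0 [simp]: "curve_integrable a b \<gamma> (\<lambda>t. 0)"
  and curve_integral_0 [simp]: "curve_integral a b \<gamma> (\<lambda>t. 0) = 0"
  by (simp_all add: curve_integrable_def curve_integral_def interval_lebesgue_integrable_def set_integrable_def)

lemma curve_integrable_sum:
  assumes "finite I" "\<And>i. i \<in> I \<Longrightarrow> curve_integrable a b \<gamma> (f i)"
  shows "curve_integrable a b \<gamma> (\<lambda>t. \<Sum>i\<in>I. f i t) \<and>
    curve_integral a b \<gamma> (\<lambda>t. \<Sum>i\<in>I. f i t) = (\<Sum>i\<in>I. curve_integral a b \<gamma> (f i))"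
  using assms by (induction I rule: finite_induct) (simp_all add: curve_integrable_add)

lemma curve_integrable_poly:
  assumes "\<And>m. curve_integrable a b \<gamma> (\<lambda>t. t ^ m * w t)"
  shows "curve_integrable a b \<gamma> (\<lambda>t. poly q t * w t)"
proof -
  have "(\<lambda>t. poly q t * w t) = (\<lambda>t. \<Sum>i\<le>degree q. coeff q i * (t ^ i * w t))"
    by (simp add: poly_altdef sum_distrib_right mult.assoc)
  then show ?thesis
    using curve_integrable_sum[of "{..degree q}" a b \<gamma> "\<lambda>i t. coeff q i * (t ^ i * w t)"]
      curve_integrable_cmult[OF assms] by simp
qed

section \<open>Differentiation along the curve\<close>

locale curve =
  fixes a b :: ereal and \<gamma> :: "real \<Rightarrow> complex"
  assumes simple: "simple_curve a b \<gamma>"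
begin

abbreviation "\<Gamma> \<equiv> curve_set a b \<gamma>"

lemma ends_less: "a < b"
  using simple unfolding simple_curve_def by (rule conjunct1)

lemma inj: "inj_on \<gamma> (einterval a b)"
  using simple[unfolded simple_curve_def, THEN conjunct2] by (rule conjunct1)

lemma piecewise_C1:
  assumes "a < ereal c" "c < d" "ereal d < b"
  shows "\<gamma> piecewise_C1_differentiable_on {c..d}"
  using simple[unfolded simple_curve_def, THEN conjunct2, THEN conjunct2, THEN conjunct1] assms
  by blast

lemma in_curve_set: "s \<in> einterval a b \<Longrightarrow> \<gamma> s \<in> \<Gamma>"
  unfolding curve_set_def by (rule imageI)

lemma open_ends: "open (einterval a b)"
  by (rule open_einterval)

lemma isCont_curve:
  assumes "s \<in> einterval a b"
  shows "isCont \<gamma> s"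
proof -
  obtain c d where cd: "a < ereal c" "c < s" "s < d" "ereal d < b"
    using assms by (rule einterval_obtain_Icc)
  then have "continuous_on {c..d} \<gamma>"
    using piecewise_C1[of c d] by (simp add: piecewise_C1_differentiable_on_def)
  then show ?thesis
    using cd continuous_on_interior[of "{c..d}" \<gamma> s] by simp
qed

lemma curve_differentiable:
  assumes "a < ereal c" "c < d" "ereal d < b"
  obtains N where "finite N"
    "\<And>s. s \<in> {c..d} - N \<Longrightarrow> (\<gamma> has_vector_derivative vector_derivative \<gamma> (at s)) (at s)"
proof -
  obtain N where "finite N" "\<gamma> C1_differentiable_on ({c..d} - N)"
    using piecewise_C1[OF assms] by (auto simp: piecewise_C1_differentiable_on_def)
  then show thesis
    using that[of N] by (simp add: C1_differentiable_on_eq vector_derivative_works[symmetric])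
qed

text \<open>Each of countably many compact intervals exhausting the parameter interval contains only
  finitely many exceptions.\<close>

lemma countable_not_differentiable:
  "countable {s \<in> einterval a b. \<not> (\<gamma> has_vector_derivative vector_derivative \<gamma> (at s)) (at s)}"
    (is "countable ?X")
proof -
  obtain u l :: "nat \<Rightarrow> real" where ul: "einterval a b = (\<Union>i. {l i .. u i})"
    "incseq u" "decseq l" "\<And>i. l i < u i" "\<And>i. a < l i" "\<And>i. u i < b"
    "l \<longlonglongrightarrow> a" "u \<longlonglongrightarrow> b"
    by (blast intro: einterval_Icc_approximation[OF ends_less])
  have "countable (?X \<inter> {l i..u i})" for i
  proof -
    obtain N where "finite N"
      "\<And>s. s \<in> {l i..u i} - N \<Longrightarrow> (\<gamma> has_vector_derivative vector_derivative \<gamma> (at s)) (at s)"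
      using curve_differentiable[OF ul(5) ul(4) ul(6)] by blast
    then have "?X \<inter> {l i..u i} \<subseteq> N" by blast
    then show ?thesis using \<open>finite N\<close> by (meson countable_finite countable_subset)
  qed
  then have "countable (\<Union>i. ?X \<inter> {l i..u i})" by (intro countable_UN) simp_all
  also have "(\<Union>i. ?X \<inter> {l i..u i}) = ?X" using ul(1) by auto
  finally show ?thesis .
qed

text \<open>Being continuous and injective, \<gamma> maps punctured neighbourhoods of
  \<open>s\<close> to points of \<Gamma> that approach \<open>\<gamma> s\<close> without meeting it.
  This is what makes derivatives along \<Gamma> unique.\<close>

lemma at_within_curve_neq_bot:
  assumes s: "s \<in> einterval a b"
  shows "at (\<gamma> s) within \<Gamma> \<noteq> bot"
proof -
  have ev: "\<forall>\<^sub>F t in at s. t \<in> einterval a b \<and> t \<noteq> s"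
    using eventually_at_in_open[OF open_ends s] by (simp add: eventually_at_filter)
  have "filterlim \<gamma> (at (\<gamma> s) within \<Gamma>) (at s)"
    unfolding filterlim_at
  proof
    show "\<forall>\<^sub>F t in at s. \<gamma> t \<in> \<Gamma> \<and> \<gamma> t \<noteq> \<gamma> s"
      using ev by (rule eventually_mono) (use s inj in \<open>auto simp: in_curve_set dest: inj_onD\<close>)
    show "(\<gamma> \<longlongrightarrow> \<gamma> s) (at s)"
      using isCont_curve[OF s] by (simp add: isCont_def)
  qed
  then show ?thesis
    using trivial_limit_at[of s] by (auto simp: filterlim_def filtermap_bot_iff bot.extremum_unique)
qed

lemma curve_deriv_eq:
  assumes "z \<in> \<Gamma>" and d: "(f has_field_derivative d) (at z within \<Gamma>)"
  shows "curve_deriv \<Gamma> f z = d"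
proof -
  have "at z within \<Gamma> \<noteq> bot"
    using at_within_curve_neq_bot assms(1) by (auto simp: curve_set_def)
  then have unique: "d' = d" if "(f has_field_derivative d') (at z within \<Gamma>)" for d'
    using that d tendsto_unique unfolding has_field_derivative_iff by blast
  have "(THE d. (f has_field_derivative d) (at z within \<Gamma>)) = d"
    using d unique by (rule the_equality)
  then show ?thesis
    unfolding curve_deriv_def using d by (subst if_P) auto
qed

lemma has_vector_derivative_along_curve:
  assumes s: "s \<in> einterval a b" and \<gamma>': "(\<gamma> has_vector_derivative \<gamma>') (at s)"
    and f: "(f has_field_derivative d) (at (\<gamma> s) within \<Gamma>)"
  shows "((\<lambda>s. f (\<gamma> s)) has_vector_derivative d * \<gamma>') (at s)"
proof -
  have "((f \<circ> \<gamma>) has_vector_derivative \<gamma>' * d) (at s within einterval a b)"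
    using f \<gamma>' by (intro field_vector_diff_chain_within)
      (auto simp: curve_set_def intro: has_vector_derivative_at_within)
  then show ?thesis
    by (simp add: at_within_open[OF s open_ends] o_def mult.commute)
qed

end

section \<open>A single weight: continuity and integration by parts\<close>

locale vanishing_weight = curve +
  fixes w :: "complex \<Rightarrow> complex"
  assumes regular: "regular_weight a b \<gamma> w"
    and vanishing: "vanishes_at_endpoints a b \<gamma> w"
begin

lemma moments_integrable:
  "curve_integrable a b \<gamma> (\<lambda>t. poly q t * w t)"
  "curve_integrable a b \<gamma> (\<lambda>t. poly q t * curve_deriv \<Gamma> w t)"
  using regular by (simp_all add: regular_weight_def Let_def curve_integrable_poly)

text \<open>The support is closed relative to \<Gamma>, so its points are either interior, where
  \<open>w\<close> is differentiable, or frontier points, where \<open>w\<close> vanishes.\<close>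

lemma differentiable_or_frontier:
  assumes "z \<in> \<Gamma>"
  obtains (interior) d where "(w has_field_derivative d) (at z within \<Gamma>)"
    | (frontier) "z \<in> weight_support \<Gamma> w" "w z = 0"
    | (exterior) "z \<notin> weight_support \<Gamma> w"
proof -
  have cl: "closedin (top_of_set \<Gamma>) (weight_support \<Gamma> w)"
    unfolding weight_support_def by (intro closedin_closed_Int closed_closure)
  then have "(top_of_set \<Gamma>) frontier_of (weight_support \<Gamma> w)
      = weight_support \<Gamma> w - (top_of_set \<Gamma>) interior_of (weight_support \<Gamma> w)"
    by (simp add: frontier_of_def closure_of_closedin)
  then show thesis
    using that regular vanishing unfolding regular_weight_def vanishes_at_endpoints_def Let_def by blast
qed

lemma weight_eq_0: "z \<in> \<Gamma> \<Longrightarrow> z \<notin> weight_support \<Gamma> w \<Longrightarrow> w z = 0"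
  unfolding weight_support_def using closure_subset[of "{z \<in> \<Gamma>. w z \<noteq> 0}"] by blast

lemma continuous_on_weight: "continuous_on \<Gamma> w"
proof (rule continuous_on_eq_continuous_within[THEN iffD2], rule ballI)
  fix z assume z: "z \<in> \<Gamma>"
  then show "continuous (at z within \<Gamma>) w"
  proof (cases rule: differentiable_or_frontier)
    case (interior d)
    then show ?thesis by (rule DERIV_continuous)
  next
    case exterior
    let ?U = "- closure {z \<in> \<Gamma>. w z \<noteq> 0}"
    have "z \<in> ?U" using exterior z by (simp add: weight_support_def)
    then have "\<forall>\<^sub>F y in at z within \<Gamma>. w y = 0"
      using eventually_at_topological[of "\<lambda>y. w y = 0" z \<Gamma>] closure_subset[of "{z \<in> \<Gamma>. w z \<noteq> 0}"]
      by (auto intro!: exI[of _ ?U])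
    then show ?thesis
      using weight_eq_0[OF z exterior] by (simp add: continuous_within tendsto_eventually)
  next
    case frontier
    show ?thesis
      unfolding continuous_within_sequentially
    proof (intro allI impI, elim conjE)
      fix x assume x: "\<forall>n. x n \<in> \<Gamma>" "x \<longlonglongrightarrow> z"
      let ?S = "weight_support \<Gamma> w"
      \<comment> \<open>A convergent sequence together with its limit is compact, so the part of it
        in the support is a set on which a single Hoelder estimate holds.\<close>
      have "compact (insert z (range x) \<inter> closure {z \<in> \<Gamma>. w z \<noteq> 0})"
        by (intro compact_Int_closed compact_sequence_with_limit x) auto
      moreover have "insert z (range x) \<inter> closure {z \<in> \<Gamma>. w z \<noteq> 0} = insert z (range x) \<inter> ?S"
        using x z by (auto simp: weight_support_def)
      ultimately have "compact (insert z (range x) \<inter> ?S)" by simp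
      moreover have "locally_holder_on ?S w"
        using regular by (simp add: regular_weight_def Let_def)
      ultimately obtain \<alpha> C where \<alpha>: "0 < \<alpha>" and C:
        "\<And>y y'. y \<in> insert z (range x) \<inter> ?S \<Longrightarrow> y' \<in> insert z (range x) \<inter> ?S \<Longrightarrow>
           norm (w y - w y') \<le> C * dist y y' powr \<alpha>"
        unfolding locally_holder_on_def by (metis inf_le2)
      \<comment> \<open>Off the support \<open>w\<close> is 0; replacing \<open>C\<close> by its
        absolute value keeps the bound valid there.\<close>
      have "norm (w (x n)) \<le> \<bar>C\<bar> * dist (x n) z powr \<alpha>" for n
      proof (cases "x n \<in> ?S")
        case True
        then have "norm (w (x n)) \<le> C * dist (x n) z powr \<alpha>"
          using C[of "x n" z] frontier by simp
        also have "\<dots> \<le> \<bar>C\<bar> * dist (x n) z powr \<alpha>"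
          by (intro mult_right_mono) auto
        finally show ?thesis .
      qed (use weight_eq_0 x in simp)
      moreover have "(\<lambda>n. \<bar>C\<bar> * dist (x n) z powr \<alpha>) \<longlonglongrightarrow> 0"
      proof -
        have "(\<lambda>n. dist (x n) z) \<longlonglongrightarrow> 0"
          using x(2) tendsto_dist_iff by blast
        then show ?thesis
          using \<alpha> by (intro tendsto_mult_right_zero tendsto_zero_powrI[of _ _ "\<lambda>_. \<alpha>"]) auto
      qed
      ultimately have "(\<lambda>n. w (x n)) \<longlonglongrightarrow> 0"
        by (intro Lim_null_comparison[of "\<lambda>n. w (x n)"]) (simp_all add: always_eventually)
      then show "(w \<circ> x) \<longlonglongrightarrow> w z"
        using frontier by (simp add: o_def)
    qed
  qed
qed

text \<open>A derivative can be missing only at zeros of \<open>w\<close>, where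
  \<open>curve_deriv\<close> has its default value 0. This is the alternative required by the
  fundamental theorem above.\<close>

lemma weight_differentiable_or_zero:
  assumes "z \<in> \<Gamma>"
  shows "(w has_field_derivative curve_deriv \<Gamma> w z) (at z within \<Gamma>) \<or> w z = 0 \<and> curve_deriv \<Gamma> w z = 0"
proof (cases "\<exists>d. (w has_field_derivative d) (at z within \<Gamma>)")
  case True
  then show ?thesis using curve_deriv_eq[OF assms] by metis
next
  case False
  then have "curve_deriv \<Gamma> w z = 0" by (simp add: curve_deriv_def)
  moreover have "w z = 0"
    using assms by (cases rule: differentiable_or_frontier) (use False weight_eq_0[OF assms] in auto)
  ultimately show ?thesis by simp
qed

text \<open>By the chain rule, such a parameter is a zero of \<open>w\<close> along \<gamma> with
  nonzero derivative, unless \<gamma> itself is not differentiable there.\<close>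

lemma countable_deriv_at_zeros:
  "countable {s \<in> einterval a b. w (\<gamma> s) = 0 \<and> curve_deriv \<Gamma> w (\<gamma> s) * vector_derivative \<gamma> (at s) \<noteq> 0}"
    (is "countable ?X")
proof (rule countable_subset)
  let ?Y = "{s \<in> einterval a b. \<not> (\<gamma> has_vector_derivative vector_derivative \<gamma> (at s)) (at s)}"
  let ?Z = "{s. w (\<gamma> s) = 0 \<and> (\<exists>D. D \<noteq> 0 \<and> ((\<lambda>s. w (\<gamma> s)) has_vector_derivative D) (at s))}"
  show "countable (?Y \<union> ?Z)"
    using countable_not_differentiable countable_zeros_nonzero_derivative[of "\<lambda>s. w (\<gamma> s)"] by blast
  show "?X \<subseteq> ?Y \<union> ?Z"
  proof
    fix s assume s: "s \<in> ?X"
    then have "(w has_field_derivative curve_deriv \<Gamma> w (\<gamma> s)) (at (\<gamma> s) within \<Gamma>)"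
      using weight_differentiable_or_zero[of "\<gamma> s"] in_curve_set by auto
    then show "s \<in> ?Y \<union> ?Z"
      using s has_vector_derivative_along_curve[of s] by blast
  qed
qed

lemma curve_integral_derivative_eq_0:
  "curve_integral a b \<gamma> (\<lambda>t. poly (pderiv q) t * w t + poly q t * curve_deriv \<Gamma> w t) = 0"
proof -
  define f where "f = (\<lambda>s. poly q (\<gamma> s) * w (\<gamma> s))"
  define h where "h = (\<lambda>s. (poly (pderiv q) (\<gamma> s) * w (\<gamma> s) + poly q (\<gamma> s) * curve_deriv \<Gamma> w (\<gamma> s))
    * vector_derivative \<gamma> (at s))"
  have "curve_integrable a b \<gamma> (\<lambda>t. poly (pderiv q) t * w t + poly q t * curve_deriv \<Gamma> w t)"
    by (intro curve_integrable_add moments_integrable)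
  then have h: "set_integrable lborel (einterval a b) h"
    using ends_less by (simp add: curve_integrable_def interval_lebesgue_integrable_def h_def)
  obtain u l :: "nat \<Rightarrow> real" where ul: "einterval a b = (\<Union>i. {l i .. u i})"
    "incseq u" "decseq l" "\<And>i. l i < u i" "\<And>i. a < l i" "\<And>i. u i < b"
    "l \<longlonglongrightarrow> a" "u \<longlonglongrightarrow> b"
    by (blast intro: einterval_Icc_approximation[OF ends_less])
  have ftc: "(LBINT s=l i..u i. h s) = f (u i) - f (l i)" for i
  proof -
    have sub: "{l i..u i} \<subseteq> einterval a b"
      using ul(1) by blast
    have hi: "set_integrable lborel {l i..u i} h"
      using set_integrable_subset[OF h _ sub] by simp
    obtain N where N: "finite N"
      "\<And>s. s \<in> {l i..u i} - N \<Longrightarrow> (\<gamma> has_vector_derivative vector_derivative \<gamma> (at s)) (at s)"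
      using curve_differentiable[OF ul(5) ul(4) ul(6)] by blast
    have "(h has_integral f (u i) - f (l i)) {l i..u i}"
    proof (rule has_integral_derivative_or_zero[OF _ _ N(1)])
      show "l i \<le> u i" using ul(4)[of i] by simp
      have \<gamma>: "continuous_on {l i..u i} \<gamma>"
        using isCont_curve sub by (intro continuous_at_imp_continuous_on) blast
      moreover have "continuous_on {l i..u i} (\<lambda>s. w (\<gamma> s))"
        by (rule continuous_on_compose2[OF continuous_on_weight \<gamma>]) (use sub in_curve_set in blast)
      ultimately show "continuous_on {l i..u i} f"
        unfolding f_def by (intro continuous_intros)
      show "h absolutely_integrable_on {l i..u i}"
        using hi set_borel_integral_eq_integral(1)[OF hi]
          set_borel_integral_eq_integral(1)[OF set_integrable_norm[OF hi]]
        by (simp add: absolutely_integrable_on_def)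
      fix s assume s: "s \<in> {l i<..<u i} - N"
      then have sI: "s \<in> einterval a b" using sub by auto
      show "(f has_vector_derivative h s) (at s) \<or> h s = 0 \<and> f s = 0"
        using weight_differentiable_or_zero[OF in_curve_set[OF sI]]
      proof
        assume *: "(w has_field_derivative curve_deriv \<Gamma> w (\<gamma> s)) (at (\<gamma> s) within \<Gamma>)"
        have "((\<lambda>t. poly q t * w t) has_field_derivative
            poly (pderiv q) (\<gamma> s) * w (\<gamma> s) + curve_deriv \<Gamma> w (\<gamma> s) * poly q (\<gamma> s)) (at (\<gamma> s) within \<Gamma>)"
          by (rule DERIV_mult[OF has_field_derivative_at_within[OF poly_DERIV] *])
        from has_vector_derivative_along_curve[OF sI N(2) this] s show ?thesis
          by (simp add: f_def h_def mult.commute)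
      qed (simp add: f_def h_def)
    qed
    then show ?thesis
      using interval_integral_eq_integral[of "l i" "u i" h] hi ul(4)[of i] by (simp add: integral_unique)
  qed
  \<comment> \<open>The boundary values need only agree in the limit: both tend to 0, or the curve
    closes up and both tend to the value at the closing point.\<close>
  have "\<exists>L. (f \<longlongrightarrow> L) (lower_end a) \<and> (f \<longlongrightarrow> L) (upper_end b)"
  proof (cases "\<forall>F \<in> {lower_end a, upper_end b}. \<forall>m::nat. ((\<lambda>s. \<gamma> s ^ m * w (\<gamma> s)) \<longlongrightarrow> 0) F")
    case True
    have "(f \<longlongrightarrow> 0) F" if "F \<in> {lower_end a, upper_end b}" for F
    proof -
      have "((\<lambda>s. \<Sum>i\<le>degree q. coeff q i * (\<gamma> s ^ i * w (\<gamma> s))) \<longlongrightarrow> (\<Sum>i\<le>degree q. coeff q i * 0)) F"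
        using True that by (intro tendsto_intros) blast
      then show ?thesis
        by (simp add: f_def poly_altdef sum_distrib_right mult.assoc)
    qed
    then show ?thesis by blast
  next
    case False
    then have "closes_up a b \<gamma>" and "\<exists>l. \<forall>F \<in> {lower_end a, upper_end b}. ((\<lambda>s. w (\<gamma> s)) \<longlongrightarrow> l) F"
      using vanishing unfolding vanishes_at_endpoints_def Let_def by blast+
    then obtain p c where "(\<gamma> \<longlongrightarrow> p) (lower_end a)" "(\<gamma> \<longlongrightarrow> p) (upper_end b)"
      "((\<lambda>s. w (\<gamma> s)) \<longlongrightarrow> c) (lower_end a)" "((\<lambda>s. w (\<gamma> s)) \<longlongrightarrow> c) (upper_end b)"
      unfolding closes_up_def by blast
    then have "(f \<longlongrightarrow> poly q p * c) (lower_end a)" "(f \<longlongrightarrow> poly q p * c) (upper_end b)"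
      unfolding f_def by (auto intro: tendsto_mult isCont_tendsto_compose[OF poly_isCont])
    then show ?thesis by blast
  qed
  then obtain c where c: "(f \<longlongrightarrow> c) (lower_end a)" "(f \<longlongrightarrow> c) (upper_end b)"
    by blast
  have "(\<lambda>i. f (u i) - f (l i)) \<longlonglongrightarrow> c - c"
    by (intro tendsto_diff tendsto_upper_end[OF c(2) ul(8) ul(6)] tendsto_lower_end[OF c(1) ul(7) ul(5)])
  moreover have "(\<lambda>i. f (u i) - f (l i)) \<longlonglongrightarrow> (LBINT s=a..b. h s)"
    using interval_integral_Icc_approx_integrable[OF ends_less ul h] by (simp only: ftc)
  ultimately have "(LBINT s=a..b. h s) = 0"
    using LIMSEQ_unique by fastforce
  then show ?thesis
    by (simp add: curve_integral_def h_def)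
qed

lemma integration_by_parts:
  "curve_integral a b \<gamma> (\<lambda>t. poly q t * curve_deriv \<Gamma> w t)
    = - curve_integral a b \<gamma> (\<lambda>t. poly (pderiv q) t * w t)"
  using curve_integral_derivative_eq_0[of q]
    curve_integrable_add(2)[OF moments_integrable(1)[of "pderiv q"] moments_integrable(2)[of q]]
  by (simp add: add_eq_0_iff)

end

section \<open>Ladder equations\<close>

locale ladder = curve a b \<gamma> + normal_functionals r "weight_integral a b \<gamma> w"
  for a b \<gamma> r w +
  fixes v' :: "nat \<Rightarrow> complex \<Rightarrow> complex"
  assumes weights: "k \<in> {1..r} \<Longrightarrow> vanishing_weight a b \<gamma> (w k)"
    and log_deriv: "neg_log_deriv \<Gamma> r w v'"
begin

lemma M_eq: "M k p = curve_integral a b \<gamma> (\<lambda>t. poly p t * w k t)"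
  by (simp add: M_def weight_integral_def)

text \<open>The integrand is prescribed only for \<open>t\<close> different from \<open>x\<close>
  because it arises by cancelling \<open>x - t\<close>; by injectivity, \<gamma> passes through
  \<open>x\<close> at most once.\<close>

lemma curve_integral_log_deriv:
  assumes f: "\<And>t. t \<noteq> x \<Longrightarrow> f t = poly p t * (\<Sum>k=1..r. poly (K k) t * (v' k t - v' k x) * w k t)"
  shows "curve_integral a b \<gamma> f = (\<Sum>k=1..r. M k (pderiv (p * K k)) - v' k x * M k (p * K k))"
proof -
  define g where "g = (\<lambda>k t. (- 1) * (poly (p * K k) t * curve_deriv \<Gamma> (w k) t)
    - v' k x * (poly (p * K k) t * w k t))"
  have g: "curve_integrable a b \<gamma> (g k)"
    "curve_integral a b \<gamma> (g k) = M k (pderiv (p * K k)) - v' k x * M k (p * K k)" if "k \<in> {1..r}" for k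
  proof -
    interpret vanishing_weight a b \<gamma> "w k" by (rule weights[OF that])
    note int = curve_integrable_cmult[OF moments_integrable(2)] curve_integrable_cmult[OF moments_integrable(1)]
    show "curve_integrable a b \<gamma> (g k)"
      unfolding g_def by (intro curve_integrable_diff int)
    show "curve_integral a b \<gamma> (g k) = M k (pderiv (p * K k)) - v' k x * M k (p * K k)"
      unfolding g_def curve_integrable_diff(2)[OF int] curve_integral_cmult integration_by_parts M_eq
      by simp
  qed
  \<comment> \<open>At a zero of \<open>w k\<close> the product \<open>v' k * w k\<close> is \<open>0\<close>, whatever the derivative of \<open>w k\<close> is; but
    the zeros with nonzero derivative are isolated, hence countably many.\<close>
  let ?X = "\<lambda>k. {s \<in> einterval a b. w k (\<gamma> s) = 0 \<and> curve_deriv \<Gamma> (w k) (\<gamma> s) * vector_derivative \<gamma> (at s) \<noteq> 0}"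
  let ?Y = "{s \<in> einterval a b. \<gamma> s = x}"
  have "countable ?Y"
  proof (rule countable_finite, cases "?Y = {}")
    case False
    then obtain s where "s \<in> ?Y" by blast
    then have "?Y \<subseteq> {s}" using inj by (auto dest: inj_onD)
    then show "finite ?Y" by (rule finite_subset) simp
  qed (simp only: finite.emptyI)
  moreover have "countable (?X k)" if "k \<in> {1..r}" for k
    using vanishing_weight.countable_deriv_at_zeros[OF weights[OF that]] .
  ultimately have X: "countable (?Y \<union> (\<Union>k\<in>{1..r}. ?X k))"
    by (intro countable_Un countable_UN) simp_all
  have "curve_integral a b \<gamma> f = curve_integral a b \<gamma> (\<lambda>t. \<Sum>k=1..r. g k t)"
    unfolding curve_integral_def
  proof (rule interval_integral_discrete_difference[OF X])
    fix s assume s: "a < ereal s" "ereal s < b" "s \<notin> ?Y \<union> (\<Union>k\<in>{1..r}. ?X k)"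
    then have sI: "s \<in> einterval a b" by (simp add: einterval_def)
    let ?t = "\<gamma> s" and ?d = "vector_derivative \<gamma> (at s)"
    have *: "v' k ?t * w k ?t * ?d = - curve_deriv \<Gamma> (w k) ?t * ?d" if k: "k \<in> {1..r}" for k
    proof (cases "w k ?t = 0")
      case True
      then show ?thesis using s k sI by auto
    next
      case False
      then show ?thesis
        using log_deriv k in_curve_set[OF sI] by (simp add: neg_log_deriv_def)
    qed
    have "f ?t * ?d = (\<Sum>k=1..r. poly (p * K k) ?t * (v' k ?t * w k ?t * ?d - v' k x * w k ?t * ?d))"
      using f[of ?t] s sI by (simp add: sum_distrib_left sum_distrib_right algebra_simps)
    also have "\<dots> = (\<Sum>k=1..r. g k ?t * ?d)"
      by (intro sum.cong refl, subst *) (simp_all add: g_def algebra_simps del: poly_mult)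
    finally show "f ?t * ?d = (\<Sum>k=1..r. g k ?t) * ?d"
      by (simp add: sum_distrib_right)
  qed (use ends_less in auto)
  also have "\<dots> = (\<Sum>k=1..r. M k (pderiv (p * K k)) - v' k x * M k (p * K k))"
    using curve_integrable_sum[of "{1..r}" a b \<gamma> g] g by simp
  finally show ?thesis .
qed

abbreviation "\<Phi> \<equiv> ladder_integrand r w v'"

text \<open>The factor \<open>x - t\<close> cancels only in the combination of the integrands, so
  the integrals, each assumed to exist, are first merged into one.\<close>

lemma ladder_combination:
  assumes K: "\<And>k. k \<in> {1..r} \<Longrightarrow> [:x, -1:] * K k = smult c0 (A n k) - (\<Sum>j=1..r. smult (c j) (A (add_unit n j) k))"
    and int: "curve_integrable a b \<gamma> (\<Phi> p (A n) x)"
      "\<And>j. j \<in> {1..r} \<Longrightarrow> curve_integrable a b \<gamma> (\<Phi> p (A (add_unit n j)) x)"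
  shows "c0 * curve_integral a b \<gamma> (\<Phi> p (A n) x)
      - (\<Sum>j=1..r. c j * curve_integral a b \<gamma> (\<Phi> p (A (add_unit n j)) x))
    = S (pderiv p) K + (\<Sum>k=1..r. M k (p * pderiv (K k))) - (\<Sum>k=1..r. v' k x * M k (p * K k))"
proof -
  define f where "f = (\<lambda>t. c0 * \<Phi> p (A n) x t - (\<Sum>j=1..r. c j * \<Phi> p (A (add_unit n j)) x t))"
  have sum: "curve_integrable a b \<gamma> (\<lambda>t. \<Sum>j=1..r. c j * \<Phi> p (A (add_unit n j)) x t) \<and>
      curve_integral a b \<gamma> (\<lambda>t. \<Sum>j=1..r. c j * \<Phi> p (A (add_unit n j)) x t)
      = (\<Sum>j=1..r. curve_integral a b \<gamma> (\<lambda>t. c j * \<Phi> p (A (add_unit n j)) x t))"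
    by (rule curve_integrable_sum) (simp_all add: curve_integrable_cmult int(2))
  have "curve_integral a b \<gamma> f = c0 * curve_integral a b \<gamma> (\<Phi> p (A n) x)
      - (\<Sum>j=1..r. c j * curve_integral a b \<gamma> (\<Phi> p (A (add_unit n j)) x))"
    unfolding f_def using curve_integrable_diff(2)[OF curve_integrable_cmult[OF int(1)] conjunct1[OF sum]] sum
    by (simp add: curve_integral_cmult)
  moreover have "curve_integral a b \<gamma> f = (\<Sum>k=1..r. M k (pderiv (p * K k)) - v' k x * M k (p * K k))"
  proof (rule curve_integral_log_deriv)
    fix t assume t: "t \<noteq> x"
    have Kt: "c0 * poly (A n k) t - (\<Sum>j=1..r. c j * poly (A (add_unit n j) k) t) = (x - t) * poly (K k) t"
      if "k \<in> {1..r}" for k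
      using arg_cong[OF K[OF that], of "\<lambda>q. poly q t"] by (simp add: poly_sum algebra_simps)
    let ?q = "\<lambda>k. (v' k t - v' k x) / (x - t) * w k t"
    have \<Phi>: "\<Phi> p B x t = (\<Sum>k=1..r. poly p t * (poly (B k) t * ?q k))" for B
      by (simp add: ladder_integrand_def sum_distrib_left mult.assoc)
    have "f t = (\<Sum>k=1..r. poly p t * ((c0 * poly (A n k) t
        - (\<Sum>j=1..r. c j * poly (A (add_unit n j) k) t)) * ?q k))"
    proof -
      have "(\<Sum>j=1..r. c j * \<Phi> p (A (add_unit n j)) x t)
          = (\<Sum>k=1..r. \<Sum>j=1..r. c j * (poly p t * (poly (A (add_unit n j) k) t * ?q k)))"
        unfolding \<Phi> sum_distrib_left by (rule sum.swap)
      also have "\<dots> = (\<Sum>k=1..r. poly p t * ((\<Sum>j=1..r. c j * poly (A (add_unit n j) k) t) * ?q k))"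
        by (simp add: sum_distrib_left sum_distrib_right mult_ac)
      finally have "f t = c0 * \<Phi> p (A n) x t
          - (\<Sum>k=1..r. poly p t * ((\<Sum>j=1..r. c j * poly (A (add_unit n j) k) t) * ?q k))"
        by (simp add: f_def)
      also have "c0 * \<Phi> p (A n) x t = (\<Sum>k=1..r. poly p t * (c0 * poly (A n k) t * ?q k))"
        unfolding \<Phi> sum_distrib_left by (intro sum.cong refl) (simp only: mult_ac)
      finally show ?thesis
        by (simp only: sum_subtractf[symmetric] right_diff_distrib[symmetric] left_diff_distrib[symmetric])
    qed
    also have "\<dots> = (\<Sum>k=1..r. poly p t * (poly (K k) t * (v' k t - v' k x) * w k t))"
      using t by (intro sum.cong refl) (simp only: Kt, simp)
    finally show "f t = poly p t * (\<Sum>k=1..r. poly (K k) t * (v' k t - v' k x) * w k t)"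
      by (simp add: sum_distrib_left)
  qed
  ultimately show ?thesis
    by (simp add: S_def pderiv_mult M_add sum.distrib sum_subtractf add_ac mult.commute)
qed

lemma ladder:
  fixes x :: complex
  assumes r: "1 \<le> r" and n: "\<And>j. j \<in> {1..r} \<Longrightarrow> 1 \<le> n j"
  defines "F \<equiv> \<lambda>p. poly (P n) x * curve_integral a b \<gamma> (\<Phi> p (A n) x)
      - (\<Sum>j=1..r. rec_coeff r (weight_integral a b \<gamma> w) n j * poly (P (sub_unit n j)) x
          * curve_integral a b \<gamma> (\<Phi> p (A (add_unit n j)) x))"
    and "E \<equiv> \<lambda>p. curve_integrable a b \<gamma> (\<Phi> p (A n) x) \<and>
      (\<forall>j\<in>{1..r}. curve_integrable a b \<gamma> (\<Phi> p (A (add_unit n j)) x))"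
  shows lowering: "E (P n) \<Longrightarrow> poly (pderiv (P n)) x = F (P n)"
    and raising: "i \<in> {1..r} \<Longrightarrow> E (P (sub_unit n i)) \<Longrightarrow>
      poly (pderiv (P (sub_unit n i))) x = F (P (sub_unit n i)) + v' i x * poly (P (sub_unit n i)) x"
proof -
  obtain K where K: "\<And>j. deg_lt (K j) (n j)" "\<And>p. deg_lt p (N n) \<Longrightarrow> S p K = poly p x"
    using reproducing_kernel[of n x] by blast
  have F: "F p = S (pderiv p) K + (\<Sum>k=1..r. M k (p * pderiv (K k))) - (\<Sum>k=1..r. v' k x * M k (p * K k))"
    if "E p" for p
    unfolding F_def using that christoffel_darboux[OF n r K]
    by (intro ladder_combination) (auto simp: E_def)
  {
    assume "E (P n)"
    have "S (pderiv (P n)) K = poly (pderiv (P n)) x"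
      using K(2) deg_lt_pderiv[OF deg_lt_type_II[of n]] by simp
    moreover have "M k (P n * pderiv (K k)) = 0" "M k (P n * K k) = 0" if "k \<in> {1..r}" for k
      using that K(1)[of k] deg_lt_mono[OF deg_lt_pderiv[OF K(1)[of k]]] by (simp_all add: M_type_II_0)
    ultimately show "poly (pderiv (P n)) x = F (P n)"
      using F[OF \<open>E (P n)\<close>] by simp
  next
    assume i: "i \<in> {1..r}" and E: "E (P (sub_unit n i))"
    let ?m = "sub_unit n i"
    have deg: "deg_lt (P ?m) (N n)"
      using deg_lt_type_II[of ?m] msize_sub_unit[OF i, of n] n[OF i] by simp
    then have 1: "S (pderiv (P ?m)) K = poly (pderiv (P ?m)) x" "S (P ?m) K = poly (P ?m) x"
      using K(2) deg_lt_mono[OF deg_lt_pderiv[OF deg]] by simp_all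
    \<comment> \<open>Differentiation lowers the degree bound of \<open>K k\<close> to
      \<open>n k - 1\<close>, which is within the orthogonality of \<open>P ?m\<close> even for
      \<open>k = i\<close>.\<close>
    have 2: "M k (P ?m * pderiv (K k)) = 0" if "k \<in> {1..r}" for k
      using that deg_lt_mono[OF deg_lt_pderiv[OF K(1)[of k]], of "?m k"]
      by (intro M_type_II_0) (auto simp: sub_unit_def)
    define m where "m = M i (P ?m * K i)"
    \<comment> \<open>In component \<open>i\<close> the kernel may have degree
      \<open>n i - 1\<close>, one too many for orthogonality. The remaining term \<open>m\<close> is
      the whole pairing of \<open>P ?m\<close> with \<open>K\<close>, hence the value of
      \<open>P ?m\<close> at \<open>x\<close>.\<close>
    have 3: "M k (P ?m * K k) = (if k = i then m else 0)" if "k \<in> {1..r}" for k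
      using that K(1)[of k] by (auto simp: m_def sub_unit_def intro!: M_type_II_0)
    have "S (P ?m) K = (\<Sum>k=1..r. if k = i then m else 0)"
      unfolding S_def by (intro sum.cong refl 3)
    then have "S (P ?m) K = m"
      using i by simp
    moreover have "(\<Sum>k=1..r. v' k x * M k (P ?m * K k)) = (\<Sum>k=1..r. if k = i then v' i x * m else 0)"
      by (intro sum.cong refl) (simp add: 3)
    then have "(\<Sum>k=1..r. v' k x * M k (P ?m * K k)) = v' i x * m"
      using i by simp
    ultimately show "poly (pderiv (P ?m)) x = F (P ?m) + v' i x * poly (P ?m) x"
      using F[OF E] 1 2 by simp
  }
qed

end

theorem theorem2p1:
  fixes r :: nat
    and a b :: ereal and \<gamma> :: "real \<Rightarrow> complex"
    and w v' :: "nat \<Rightarrow> complex \<Rightarrow> complex"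
    and n :: "nat \<Rightarrow> nat" and x :: complex
  defines "L \<equiv> weight_integral a b \<gamma> w"
    and "\<Gamma> \<equiv> curve_set a b \<gamma>"
  defines "P \<equiv> type_II r L"
    and "A \<equiv> type_I r L"
    and "\<alpha> \<equiv> rec_coeff r L"
    and "\<Phi> \<equiv> ladder_integrand r w v'"
  assumes "r \<ge> 1"
    and "simple_curve a b \<gamma>"
    and "\<And>k. k \<in> {1..r} \<Longrightarrow> regular_weight a b \<gamma> (w k)"
    and "\<And>k. k \<in> {1..r} \<Longrightarrow> vanishes_at_endpoints a b \<gamma> (w k)"
    and "\<And>m. normal_index r L m"
    and "\<And>m. weights_independent \<Gamma> r w m"
    and "neg_log_deriv \<Gamma> r w v'"
    and "\<And>j. j \<in> {1..r} \<Longrightarrow> n j \<ge> 1"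
  shows "(curve_integrable a b \<gamma> (\<Phi> (P n) (A n) x) \<and>
          (\<forall>j\<in>{1..r}. curve_integrable a b \<gamma> (\<Phi> (P n) (A (add_unit n j)) x)) \<longrightarrow>
          poly (pderiv (P n)) x =
            poly (P n) x * curve_integral a b \<gamma> (\<Phi> (P n) (A n) x)
            - (\<Sum>j=1..r. \<alpha> n j * poly (P (sub_unit n j)) x
                 * curve_integral a b \<gamma> (\<Phi> (P n) (A (add_unit n j)) x)))
       \<and> (\<forall>i\<in>{1..r}.
          curve_integrable a b \<gamma> (\<Phi> (P (sub_unit n i)) (A n) x) \<and>
          (\<forall>j\<in>{1..r}. curve_integrable a b \<gamma> (\<Phi> (P (sub_unit n i)) (A (add_unit n j)) x)) \<longrightarrow>
          poly (pderiv (P (sub_unit n i))) x =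
            poly (P n) x * curve_integral a b \<gamma> (\<Phi> (P (sub_unit n i)) (A n) x)
            - (\<Sum>j=1..r. (\<alpha> n j * curve_integral a b \<gamma> (\<Phi> (P (sub_unit n i)) (A (add_unit n j)) x)
                 - v' i x * (if i = j then 1 else 0)) * poly (P (sub_unit n j)) x))"
proof -
  interpret cv: curve a b \<gamma>
    by standard (fact \<open>simple_curve a b \<gamma>\<close>)
  have weights: "vanishing_weight a b \<gamma> (w k)" if "k \<in> {1..r}" for k
    by standard (use assms(9,10)[OF that] in simp_all)
  interpret lad: ladder a b \<gamma> r w v'
  proof
    fix j p q and c :: complex assume "j \<in> {1..r}"
    then interpret vw: vanishing_weight a b \<gamma> "w j" by (rule weights)
    show "weight_integral a b \<gamma> w j (poly (p + q)) = weight_integral a b \<gamma> w j (poly p) + weight_integral a b \<gamma> w j (poly q)"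
      using curve_integrable_add(2)[OF vw.moments_integrable(1)[of p] vw.moments_integrable(1)[of q]]
      by (simp add: weight_integral_def distrib_right)
    show "weight_integral a b \<gamma> w j (poly (smult c p)) = c * weight_integral a b \<gamma> w j (poly p)"
      by (simp add: weight_integral_def curve_integral_cmult mult.assoc)
  next
    show "normal_index r (weight_integral a b \<gamma> w) n" for n
      using assms(11) by (simp add: L_def)
    show "neg_log_deriv (curve_set a b \<gamma>) r w v'"
      using assms(13) by (simp add: \<Gamma>_def)
  qed (use assms(9,10) in simp_all)
  note defs = P_def A_def \<alpha>_def \<Phi>_def L_def
  \<comment> \<open>The Kronecker delta leaves only \<open>j = i\<close>; the term taken out of the
    sum is the extra summand in \<open>lad.raising\<close>.\<close>
  have raising': "(\<Sum>j=1..r. (\<alpha> n j * c j - v' i x * (if i = j then 1 else 0)) * poly (P (sub_unit n j)) x)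
      = (\<Sum>j=1..r. \<alpha> n j * poly (P (sub_unit n j)) x * c j) - v' i x * poly (P (sub_unit n i)) x"
    if "i \<in> {1..r}" for i c
  proof -
    have "(\<Sum>j=1..r. (\<alpha> n j * c j - v' i x * (if i = j then 1 else 0)) * poly (P (sub_unit n j)) x)
        = (\<Sum>j=1..r. \<alpha> n j * poly (P (sub_unit n j)) x * c j
            - (if i = j then v' i x * poly (P (sub_unit n i)) x else 0))"
      by (intro sum.cong refl) (simp add: algebra_simps)
    then show ?thesis
      using that by (simp add: sum_subtractf)
  qed
  show ?thesis
  proof (intro conjI impI ballI)
    assume "curve_integrable a b \<gamma> (\<Phi> (P n) (A n) x) \<and>
      (\<forall>j\<in>{1..r}. curve_integrable a b \<gamma> (\<Phi> (P n) (A (add_unit n j)) x))"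
    then show "poly (pderiv (P n)) x = poly (P n) x * curve_integral a b \<gamma> (\<Phi> (P n) (A n) x)
        - (\<Sum>j=1..r. \<alpha> n j * poly (P (sub_unit n j)) x
             * curve_integral a b \<gamma> (\<Phi> (P n) (A (add_unit n j)) x))"
      using lad.lowering[where n=n and x=x, OF \<open>r \<ge> 1\<close> assms(14)] unfolding defs by blast
  next
    fix i assume i: "i \<in> {1..r}"
      and "curve_integrable a b \<gamma> (\<Phi> (P (sub_unit n i)) (A n) x) \<and>
        (\<forall>j\<in>{1..r}. curve_integrable a b \<gamma> (\<Phi> (P (sub_unit n i)) (A (add_unit n j)) x))"
    then show "poly (pderiv (P (sub_unit n i))) x =
        poly (P n) x * curve_integral a b \<gamma> (\<Phi> (P (sub_unit n i)) (A n) x)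
        - (\<Sum>j=1..r. (\<alpha> n j * curve_integral a b \<gamma> (\<Phi> (P (sub_unit n i)) (A (add_unit n j)) x)
             - v' i x * (if i = j then 1 else 0)) * poly (P (sub_unit n j)) x)"
      unfolding raising'[OF i] diff_diff_eq2 diff_add_eq[symmetric]
      using lad.raising[where n=n and x=x, OF \<open>r \<ge> 1\<close> assms(14) i] unfolding defs by blast
  qed
qed

end
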